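(* Let $D=(0,1)$. Let $q\in L^\infty(0,1)$ be real-valued. There exists $\delta>0$, depending only on $q$, such that the following holds for all real-valued $\chi_1,\chi_2$ on $D$ with $\|\chi_1\|_{L^\infty}+\|\chi_2\|_{L^\infty}<\infty$ and $\chi_2(x)>0$ for a.e. $x\in D$: if $\omega\in(0,\delta]$ and $0\neq\bm{u}=(u_1,u_2)\in X$ with $u_1$ real-valued, then $$T_\omega(\bm{u})\neq0.$$ Moreover, when $q=1$ one can take $\delta=\frac{\pi}{2}$.
   Context: All functions in $L^2=L^2(0,1)$ and $H^2=H^2(0,1)$ are complex-valued unless stated otherwise. $H^2$ carries the inner product $\langle u,v\rangle_{H^2}=\langle u,v\rangle_{L^2}+\langle u'',v''\rangle_{L^2}$ (its norm is equivalent to the standard one). $X=H^2\times L^2$, with elements $\bm{u}=(u_1,u_2)$, inner product $\langle\bm{u},\bm{\phi}\rangle_X=\langle u_1,\phi_1\rangle_{H^2}+\langle u_2,\phi_2\rangle_{L^2}$ and induced norm $\|\cdot\|_X$. For $\omega\in\mathbb{C}$, the (nonlinear) operator $T_\omega:X\to X$ is defined via the Riesz representation theorem by requiring, for all $\bm{u},\bm{\phi}\in X$, $$\langle T_\omega(\bm{u}),\bm{\phi}\rangle_X=\int_0^1\left[(u_1''+\omega^2 q u_1)\overline{\phi}_2+\omega^2\chi_1u_2\overline{u}_1\overline{\phi}_2\right]dx+\int_0^1\left[u_2(\overline{\phi}_1''+4\omega^2q\overline{\phi}_1)+\omega^2\chi_2u_1^2\overline{\phi}_1\right]dx .$$ 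*)

theory Defs
  imports "HOL-Analysis.Analysis"
begin

text \<open>
  Elements of \<open>L\<^sup>2\<close>, \<open>H\<^sup>2\<close>, \<open>L\<^sup>\<infinity>\<close> and \<open>X\<close> are represented by functions on the real line of which
  only the behaviour on \<open>D = (0,1)\<close>, up to Lebesgue null sets, matters.  Equality in \<open>X\<close> is
  therefore \<open>X_eq\<close>, not equality of representatives.
\<close>

abbreviation mD :: "real measure" where
  "mD \<equiv> lebesgue_on {0<..<1}"

definition Linfty :: "(real \<Rightarrow> real) set" where
  "Linfty = {f \<in> borel_measurable mD. \<exists>C. AE x in mD. \<bar>f x\<bar> \<le> C}"

definition L2 :: "(real \<Rightarrow> complex) set" where
  "L2 = {f \<in> borel_measurable mD. integrable mD (\<lambda>x. (cmod (f x))\<^sup>2)}"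

definition test_function :: "(real \<Rightarrow> real) \<Rightarrow> bool" where
  "test_function \<phi> \<longleftrightarrow>
     (\<forall>k x. (deriv ^^ k) \<phi> differentiable (at x)) \<and>
     (\<exists>K. compact K \<and> K \<subseteq> {0<..<1} \<and> (\<forall>x. x \<notin> K \<longrightarrow> \<phi> x = 0))"

text \<open>By linearity, real-valued test functions suffice for complex-valued \<open>u\<close>.\<close>

definition has_weak_deriv :: "nat \<Rightarrow> (real \<Rightarrow> complex) \<Rightarrow> (real \<Rightarrow> complex) \<Rightarrow> bool" where
  "has_weak_deriv k u v \<longleftrightarrow>
     (\<forall>\<phi>. test_function \<phi> \<longrightarrow>
        (LINT x|mD. u x * complex_of_real ((deriv ^^ k) \<phi> x)) =
        (-1) ^ k * (LINT x|mD. v x * complex_of_real (\<phi> x)))"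

definition H2 :: "(real \<Rightarrow> complex) set" where
  "H2 = {u \<in> L2. \<forall>k\<in>{1,2}. \<exists>v\<in>L2. has_weak_deriv k u v}"

text \<open>The second weak derivative; for \<open>u \<in> H2\<close> it is determined up to a null set.\<close>

definition wderiv2 :: "(real \<Rightarrow> complex) \<Rightarrow> real \<Rightarrow> complex" where
  "wderiv2 u = (SOME v. v \<in> L2 \<and> has_weak_deriv 2 u v)"

definition L2_inner :: "(real \<Rightarrow> complex) \<Rightarrow> (real \<Rightarrow> complex) \<Rightarrow> complex" where
  "L2_inner u v = (LINT x|mD. u x * cnj (v x))"

definition H2_inner :: "(real \<Rightarrow> complex) \<Rightarrow> (real \<Rightarrow> complex) \<Rightarrow> complex" where
  "H2_inner u v = L2_inner u v + L2_inner (wderiv2 u) (wderiv2 v)"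

type_synonym fun_pair = "(real \<Rightarrow> complex) \<times> (real \<Rightarrow> complex)"

definition X_space :: "fun_pair set" where
  "X_space = H2 \<times> L2"

definition X_inner :: "fun_pair \<Rightarrow> fun_pair \<Rightarrow> complex" where
  "X_inner u \<phi> = H2_inner (fst u) (fst \<phi>) + L2_inner (snd u) (snd \<phi>)"

definition X_eq :: "fun_pair \<Rightarrow> fun_pair \<Rightarrow> bool" where
  "X_eq u v \<longleftrightarrow> (AE x in mD. fst u x = fst v x) \<and> (AE x in mD. snd u x = snd v x)"

definition X_zero :: fun_pair where
  "X_zero = ((\<lambda>_. 0), (\<lambda>_. 0))"

definition T_form ::
  "(real \<Rightarrow> real) \<Rightarrow> (real \<Rightarrow> real) \<Rightarrow> (real \<Rightarrow> real) \<Rightarrow> complex \<Rightarrow> fun_pair \<Rightarrow> fun_pair \<Rightarrow> complex"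
where
  "T_form q \<chi>1 \<chi>2 \<omega> u \<phi> =
     (case u of (u1, u2) \<Rightarrow> case \<phi> of (\<phi>1, \<phi>2) \<Rightarrow>
       (LINT x|mD. (wderiv2 u1 x + \<omega>\<^sup>2 * complex_of_real (q x) * u1 x) * cnj (\<phi>2 x)
                 + \<omega>\<^sup>2 * complex_of_real (\<chi>1 x) * u2 x * cnj (u1 x) * cnj (\<phi>2 x))
     + (LINT x|mD. u2 x * (cnj (wderiv2 \<phi>1 x) + 4 * \<omega>\<^sup>2 * complex_of_real (q x) * cnj (\<phi>1 x))
                 + \<omega>\<^sup>2 * complex_of_real (\<chi>2 x) * (u1 x)\<^sup>2 * cnj (\<phi>1 x)))"

text \<open>
  A representative of the Riesz representer of the form; the representer is unique with respect
  to \<open>X_eq\<close>.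
\<close>

definition T ::
  "(real \<Rightarrow> real) \<Rightarrow> (real \<Rightarrow> real) \<Rightarrow> (real \<Rightarrow> real) \<Rightarrow> complex \<Rightarrow> fun_pair \<Rightarrow> fun_pair"
where
  "T q \<chi>1 \<chi>2 \<omega> u =
     (SOME v. v \<in> X_space \<and> (\<forall>\<phi>\<in>X_space. X_inner v \<phi> = T_form q \<chi>1 \<chi>2 \<omega> u \<phi>))"

end

theory Submission
  imports Defs
begin

text \<open>
  Suppose \<open>T u = 0\<close> and test with \<open>(\<phi>, 0)\<close>.  If \<open>\<phi>'' + 4 \<omega>\<^sup>2 q \<phi> = 0\<close> and \<open>\<phi> > 0\<close> on \<open>(0,1)\<close>, only
  \<open>\<integral> \<chi>\<^sub>2 u\<^sub>1\<^sup>2 \<phi> = 0\<close> remains, so \<open>u\<^sub>1 = 0\<close>.  Such a \<open>\<phi>\<close> is a small perturbation of \<open>1\<close> for small \<open>\<omega>\<close>,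
  and \<open>cos (2 \<omega> (x - 1/2))\<close> for \<open>q = 1\<close> and \<open>\<omega> \<le> \<pi>/2\<close>.  Testing next with a solution of
  \<open>\<phi>'' + 4 \<omega>\<^sup>2 q \<phi> = u\<^sub>2\<close> gives \<open>u\<^sub>2 = 0\<close>.

  Since \<open>T\<close> is a Hilbert choice, the Riesz representer has to be shown to exist.  Instead of
  proving that \<open>H\<^sup>2\<close> is complete, it is obtained by solving a fourth-order boundary value problem.
  Everything is expressed through the primitive \<open>J h x = \<integral>\<^sub>0\<^sup>x h\<close>: up to null sets, the elements of
  \<open>H\<^sup>2\<close> are the functions \<open>a + b x + J (J g)\<close> with \<open>g \<in> L\<^sup>2\<close>, and then \<open>g\<close> is the weak second derivative.
\<close>

text \<open>Since \<open>H2\<close> imposes no boundary conditions, the test functions may be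
  solutions of initial value problems, which exist for every \<omega>: no resonance has to be
  avoided, and smallness of \<omega> serves only to keep \<phi> positive. The square in the \<chi>2
  term carries no modulus; it is the reality of \<open>u1\<close> that makes this term nonnegative
  against \<phi>.

  The same absence of boundary conditions shapes the representer. Testing against all of
  \<open>H2\<close> forces natural boundary conditions on the fourth-order problem. At 0 they are
  built into \<open>J\<close>; at 1 they become two moment conditions, to be met by the two
  constants in a + b x. This is a 2 x 2 linear system, so solvability reduces to uniqueness, and
  uniqueness follows from an energy identity in which two squared L2 norms add up to 0.

  The coefficient \<open>q\<close> is only measurable and essentially bounded, so differential
  equations appear in integral form and are solved by Picard iteration.\<close>

lemma finite_measure_mD: "finite_measure mD"
  by (intro finite_measure_lebesgue_on) simp

interpretation mD: finite_measure mD
  by (rule finite_measure_mD)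

interpretation mD2: pair_sigma_finite mD mD
  by unfold_locales

lemma measure_mD_space: "measure mD (space mD) = 1"
  by (simp add: measure_restrict_space)

lemma ident_measurable_mD [measurable]: "(\<lambda>x. x) \<in> borel_measurable mD"
  by (intro measurable_restrict_space1 borel_measurable_if_D measurable_completion) simp

section \<open>Square-integrable functions on the unit interval\<close>

lemma integrable_mD_bounded:
  fixes f :: "real \<Rightarrow> 'a::{banach,second_countable_topology}"
  assumes "f \<in> borel_measurable mD" "\<And>x. x \<in> {0<..<1} \<Longrightarrow> norm (f x) \<le> M"
  shows "integrable mD f"
  by (rule mD.integrable_const_bound[of _ M]) (use assms in auto)

lemma L2_iff_integrable:
  assumes "f \<in> borel_measurable mD"
  shows "f \<in> L2 \<longleftrightarrow> integrable mD (\<lambda>x. (cmod (f x))\<^sup>2)"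
  using assms by (simp add: L2_def)

lemma L2_measurable [measurable_dest]: "f \<in> L2 \<Longrightarrow> f \<in> borel_measurable mD"
  by (simp add: L2_def)

lemma L2_mult_integrable:
  assumes "f \<in> L2" "g \<in> L2"
  shows "integrable mD (\<lambda>x. f x * g x)"
proof (rule Bochner_Integration.integrable_bound)
  show "integrable mD (\<lambda>x. (cmod (f x))\<^sup>2 + (cmod (g x))\<^sup>2)"
    using assms by (auto simp: L2_def)
  have "cmod a * cmod b \<le> (cmod a)\<^sup>2 + (cmod b)\<^sup>2" for a b
    using sum_squares_bound[of "cmod a" "cmod b"]
      mult_nonneg_nonneg[OF norm_ge_zero[of a] norm_ge_zero[of b]] by linarith
  then show "AE x in mD. norm (f x * g x) \<le> norm ((cmod (f x))\<^sup>2 + (cmod (g x))\<^sup>2)"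
    by (auto simp: norm_mult)
qed (use assms in measurable)

lemma L2_bounded:
  assumes "f \<in> borel_measurable mD" "\<And>x. x \<in> {0<..<1} \<Longrightarrow> cmod (f x) \<le> M"
  shows "f \<in> L2"
  using assms(1)
proof (subst L2_iff_integrable)
  have "(cmod (f x))\<^sup>2 \<le> M\<^sup>2" if "x \<in> {0<..<1}" for x
    by (rule power_mono) (use assms(2)[OF that] in auto)
  then show "integrable mD (\<lambda>x. (cmod (f x))\<^sup>2)"
    using assms(1) by (intro integrable_mD_bounded[of _ "M\<^sup>2"]) auto
qed

lemma L2_const: "(\<lambda>x. c) \<in> L2"
  by (rule L2_bounded[of _ "cmod c"]) auto

lemma L2_integrable: "f \<in> L2 \<Longrightarrow> integrable mD f"
  using L2_mult_integrable[of f "\<lambda>_. 1"] L2_const by simp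

lemma L2_cnj: "f \<in> L2 \<Longrightarrow> (\<lambda>x. cnj (f x)) \<in> L2"
  by (auto simp: L2_def intro!: measurable_compose[OF _ borel_measurable_continuous_onI[of cnj]] continuous_intros)

lemma L2_bounded_mult:
  assumes "f \<in> borel_measurable mD" "AE x in mD. cmod (f x) \<le> M" "g \<in> L2"
  shows "(\<lambda>x. f x * g x) \<in> L2"
proof -
  have [measurable]: "f \<in> borel_measurable mD" "g \<in> borel_measurable mD"
    using assms by (auto simp: L2_def)
  have "integrable mD (\<lambda>x. (cmod (f x * g x))\<^sup>2)"
  proof (rule Bochner_Integration.integrable_bound)
    show "integrable mD (\<lambda>x. M\<^sup>2 * (cmod (g x))\<^sup>2)"
      using assms by (auto simp: L2_def)
    show "AE x in mD. norm ((cmod (f x * g x))\<^sup>2) \<le> norm (M\<^sup>2 * (cmod (g x))\<^sup>2)"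
      using assms(2) by eventually_elim
        (auto simp: norm_mult power_mult_distrib intro!: mult_right_mono power_mono)
  qed measurable
  then show ?thesis by (simp add: L2_def)
qed

lemma L2_add:
  assumes "f \<in> L2" "g \<in> L2"
  shows "(\<lambda>x. f x + g x) \<in> L2"
proof -
  have [measurable]: "f \<in> borel_measurable mD" "g \<in> borel_measurable mD"
    using assms by (auto simp: L2_def)
  have "integrable mD (\<lambda>x. (cmod (f x + g x))\<^sup>2)"
  proof (rule Bochner_Integration.integrable_bound)
    show "integrable mD (\<lambda>x. 2 * (cmod (f x))\<^sup>2 + 2 * (cmod (g x))\<^sup>2)"
      using assms by (auto simp: L2_def)
    have "(cmod (a + b))\<^sup>2 \<le> 2 * (cmod a)\<^sup>2 + 2 * (cmod b)\<^sup>2" for a b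
    proof -
      have "(cmod (a + b))\<^sup>2 \<le> (cmod a + cmod b)\<^sup>2"
        by (intro power_mono norm_triangle_ineq) auto
      also have "\<dots> \<le> 2 * (cmod a)\<^sup>2 + 2 * (cmod b)\<^sup>2"
        using sum_squares_bound[of "cmod a" "cmod b"] by (simp add: power2_sum)
      finally show ?thesis .
    qed
    then show "AE x in mD. norm ((cmod (f x + g x))\<^sup>2) \<le> norm (2 * (cmod (f x))\<^sup>2 + 2 * (cmod (g x))\<^sup>2)"
      by auto
  qed measurable
  then show ?thesis by (simp add: L2_def)
qed

lemma L2_cmult: "f \<in> L2 \<Longrightarrow> (\<lambda>x. c * f x) \<in> L2"
  by (rule L2_bounded_mult[of _ "cmod c"]) auto

lemma L2_diff: "f \<in> L2 \<Longrightarrow> g \<in> L2 \<Longrightarrow> (\<lambda>x. f x - g x) \<in> L2"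
  using L2_add[of f "\<lambda>x. - 1 * g x"] L2_cmult[of g "- 1"] by simp

lemma L2_AE_cong:
  assumes "f \<in> L2" "g \<in> borel_measurable mD" "AE x in mD. g x = f x"
  shows "g \<in> L2"
proof -
  have "integrable mD (\<lambda>x. (cmod (f x))\<^sup>2) \<longleftrightarrow> integrable mD (\<lambda>x. (cmod (g x))\<^sup>2)"
    using assms by (intro integrable_cong_AE) (auto simp: L2_def)
  with assms show ?thesis by (simp add: L2_def)
qed

lemma L2_Linfty_mult:
  assumes "q \<in> Linfty" "f \<in> L2"
  shows "(\<lambda>x. complex_of_real (q x) * f x) \<in> L2"
proof -
  obtain C where "q \<in> borel_measurable mD" "AE x in mD. \<bar>q x\<bar> \<le> C"
    using assms by (auto simp: Linfty_def)
  then show ?thesis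
    using assms(2) by (intro L2_bounded_mult[of _ C]) auto
qed

lemma L2_norm_eq_0:
  assumes "f \<in> L2" "(LINT x|mD. (cmod (f x))\<^sup>2) = 0"
  shows "AE x in mD. f x = 0"
  using assms by (subst (asm) integral_nonneg_eq_0_iff_AE) (auto simp: L2_def)

lemma L2_inner_self: "L2_inner f f = of_real (LINT x|mD. (cmod (f x))\<^sup>2)"
  unfolding L2_inner_def by (simp only: complex_norm_square[symmetric] integral_complex_of_real)

lemma AE_mD_I: "(\<And>x. 0 < x \<Longrightarrow> x < 1 \<Longrightarrow> P x) \<Longrightarrow> AE x in mD. P x"
  by (rule AE_I2) auto

lemma AE_mD_neq: "AE x in mD. x \<noteq> t"
proof -
  have "AE x in lebesgue. x \<noteq> t"
    by (rule AE_I'[of "{t}"]) (auto simp: null_sets_completionI)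
  then show ?thesis
    by (subst AE_restrict_space_iff) (auto elim: eventually_mono)
qed

subsection \<open>The primitive vanishing at 0\<close>

text \<open>The cutoff sits in the integrand, so the domain of integration stays fixed:
  measurability of \<open>J h\<close> and exchange of integrals reduce to Fubini on
  \<open>mD\<close> with itself, and only the values of \<open>h\<close> on (0,1) count.\<close>

definition J :: "(real \<Rightarrow> complex) \<Rightarrow> real \<Rightarrow> complex" where
  "J h x = (LINT t|mD. (if t < x then h t else 0))"

lemma J_integrand:
  fixes h :: "real \<Rightarrow> 'a::{banach,second_countable_topology}"
  assumes "integrable mD h"
  shows "integrable mD (\<lambda>t. if t < x then h t else 0)"
proof (rule Bochner_Integration.integrable_bound[OF assms])
  have [measurable]: "h \<in> borel_measurable mD" using assms by auto
  show "(\<lambda>t. if t < x then h t else 0) \<in> borel_measurable mD"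
    by measurable
qed auto

lemma J_0 [simp]: "J (\<lambda>x. 0) = (\<lambda>x. 0)"
  by (simp add: J_def fun_eq_iff)

lemma J_cong_AE:
  assumes "h \<in> borel_measurable mD" "g \<in> borel_measurable mD" "AE x in mD. h x = g x"
  shows "J h x = J g x"
proof -
  have [measurable]: "h \<in> borel_measurable mD" "g \<in> borel_measurable mD" using assms by auto
  show ?thesis
    unfolding J_def by (rule integral_cong_AE) (measurable, use assms(3) in \<open>auto elim: eventually_mono\<close>)
qed

lemma J_measurable [measurable]:
  assumes [measurable]: "h \<in> borel_measurable mD"
  shows "J h \<in> borel_measurable mD"
  unfolding J_def[abs_def] by measurable

lemma norm_J_le:
  assumes "integrable mD h"
  shows "cmod (J h x) \<le> (LINT t|mD. (if t < x then cmod (h t) else 0))"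
proof -
  have "cmod (J h x) \<le> (LINT t|mD. norm (if t < x then h t else 0))"
    unfolding J_def by (rule integral_norm_bound)
  also have "\<dots> = (LINT t|mD. (if t < x then cmod (h t) else 0))"
    by (intro Bochner_Integration.integral_cong) auto
  finally show ?thesis .
qed

lemma norm_J_bound:
  assumes "integrable mD h"
  shows "cmod (J h x) \<le> (LINT t|mD. cmod (h t))"
proof -
  have "(LINT t|mD. (if t < x then cmod (h t) else 0)) \<le> (LINT t|mD. cmod (h t))"
    by (intro integral_mono J_integrand) (use assms in auto)
  with norm_J_le[OF assms, of x] show ?thesis by simp
qed

lemma J_L2: "integrable mD h \<Longrightarrow> J h \<in> L2"
  by (rule L2_bounded[of "J h"]) (auto intro: J_measurable norm_J_bound)

lemma J_integrable: "integrable mD h \<Longrightarrow> integrable mD (J h)"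
  by (rule L2_integrable) (rule J_L2)

lemma J_add:
  assumes "integrable mD f" "integrable mD g"
  shows "J (\<lambda>x. f x + g x) x = J f x + J g x"
  unfolding J_def
  by (subst Bochner_Integration.integral_add[symmetric])
     (use assms in \<open>auto intro!: J_integrand Bochner_Integration.integral_cong\<close>)

lemma J_cmult: "J (\<lambda>x. c * f x) x = c * J f x"
  unfolding J_def
  by (subst Bochner_Integration.integral_mult_right_zero[symmetric]) (rule Bochner_Integration.integral_cong; simp)

lemma J_diff:
  assumes "integrable mD f" "integrable mD g"
  shows "J (\<lambda>x. f x - g x) x = J f x - J g x"
  using J_add[of f "\<lambda>x. - 1 * g x"] J_cmult[of "- 1" g] assms by auto

lemma J_cnj: "J (\<lambda>x. cnj (f x)) x = cnj (J f x)"
  unfolding J_def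
  by (subst Bochner_Integration.integral_cnj[symmetric]) (rule Bochner_Integration.integral_cong; simp)

lemma integrable_mD_pair:
  fixes h g :: "real \<Rightarrow> complex"
  assumes "integrable mD h" "integrable mD g"
  shows "integrable (mD \<Otimes>\<^sub>M mD) (\<lambda>(x, t). g x * h t)"
proof -
  have [measurable]: "h \<in> borel_measurable mD" "g \<in> borel_measurable mD" using assms by auto
  show ?thesis
    by (rule mD2.Fubini_integrable)
       (use assms in \<open>auto simp: norm_mult split_beta\<close>)
qed

text \<open>Fubini on the triangle \<open>t < x\<close>, the diagonal being a null set.\<close>

lemma integral_J_mult:
  assumes "integrable mD h" "integrable mD g"
  shows "(LINT x|mD. J h x * g x)
    = (LINT x|mD. h x) * (LINT x|mD. g x) - (LINT x|mD. h x * J g x)"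
proof -
  have [measurable]: "h \<in> borel_measurable mD" "g \<in> borel_measurable mD" using assms by auto
  have int: "integrable (mD \<Otimes>\<^sub>M mD) (\<lambda>(x, t). if t < x then g x * h t else 0)"
  proof (rule Bochner_Integration.integrable_bound[OF integrable_mD_pair[OF assms]])
    show "(\<lambda>(x, t). if t < x then g x * h t else 0) \<in> borel_measurable (mD \<Otimes>\<^sub>M mD)"
      by measurable
  qed auto
  have "(LINT x|mD. J h x * g x) = (LINT x|mD. LINT t|mD. (if t < x then g x * h t else 0))"
    unfolding J_def
    by (subst Bochner_Integration.integral_mult_left_zero[symmetric])
      (intro Bochner_Integration.integral_cong; simp add: if_distrib mult.commute cong: if_cong)
  also have "\<dots> = (LINT t|mD. LINT x|mD. (if t < x then g x * h t else 0))"
    by (rule mD2.Fubini_integral[symmetric]) (use int in \<open>simp add: split_beta\<close>)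
  also have "\<dots> = (LINT t|mD. h t * ((LINT x|mD. g x) - J g t))"
  proof (rule Bochner_Integration.integral_cong, simp)
    fix t
    have "(LINT x|mD. (if t < x then g x * h t else 0))
        = (LINT x|mD. h t * (g x - (if x < t then g x else 0)))"
      by (rule integral_cong_AE; measurable?) (use AE_mD_neq[of t] in \<open>auto elim: eventually_mono\<close>)
    also have "\<dots> = h t * ((LINT x|mD. g x) - J g t)"
      unfolding J_def using assms by (subst Bochner_Integration.integral_diff[symmetric])
        (auto intro: J_integrand)
    finally show "(LINT x|mD. (if t < x then g x * h t else 0)) = h t * ((LINT x|mD. g x) - J g t)" .
  qed
  also have "\<dots> = (LINT t|mD. h t * (LINT x|mD. g x) - h t * J g t)"
    by (simp add: algebra_simps)
  also have "\<dots> = (LINT x|mD. h x) * (LINT x|mD. g x) - (LINT x|mD. h x * J g x)"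
  proof (subst Bochner_Integration.integral_diff)
    show "integrable mD (\<lambda>x. h x * J g x)"
    proof (rule Bochner_Integration.integrable_bound)
      show "integrable mD (\<lambda>x. (LINT t|mD. cmod (g t)) * cmod (h x))" using assms by auto
      show "AE x in mD. norm (h x * J g x) \<le> norm ((LINT t|mD. cmod (g t)) * cmod (h x))"
        using norm_J_bound[OF assms(2)]
        by (auto simp: norm_mult mult.commute[of _ "cmod (h _)"] intro!: AE_I2 mult_left_mono)
    qed measurable
  qed (use assms in auto)
  finally show ?thesis .
qed

text \<open>The link to classical calculus: the Henstock-Kurzweil fundamental theorem holds on
  closed intervals, and dropping the end points does not change the integral. It is applied to test
  functions, exponentials and the cosine.\<close>

lemma
  fixes F f :: "real \<Rightarrow> complex"
  assumes deriv: "\<And>x. (F has_vector_derivative f x) (at x)"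
    and cont: "continuous_on {0..1} f"
  shows FTC_mD: "(LINT x|mD. f x) = F 1 - F 0"
    and FTC_J: "0 < x \<Longrightarrow> x < 1 \<Longrightarrow> J f x = F x - F 0"
    and FTC_integrable: "integrable mD f"
proof -
  \<comment> \<open>The right end point is a parameter: \<open>b = 1\<close> gives the integral over
    (0,1), \<open>b = x\<close> gives \<open>J f x\<close>.\<close>
  have int_on: "integrable (lebesgue_on {0<..<b}) f \<and> (LINT x|lebesgue_on {0<..<b}. f x) = F b - F 0"
    if "0 < b" "b \<le> 1" for b
  proof -
    have c: "continuous_on {0..b} f"
      using continuous_on_subset[OF cont] that by auto
    have "integrable (lebesgue_on {0..b}) f"
      using c by (intro continuous_imp_integrable_real)
    then have 1: "integrable (lebesgue_on {0<..<b}) f"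
      by (simp add: integrable_restrict_space set_integrable_def[symmetric])
        (rule set_integrable_subset, auto)
    have "(f has_integral (F b - F 0)) {0..b}"
      by (rule fundamental_theorem_of_calculus)
         (use that deriv in \<open>auto intro: has_vector_derivative_at_within\<close>)
    then have "(f has_integral (F b - F 0)) {0<..<b}"
      by (simp add: has_integral_Icc_iff_Ioo)
    then show ?thesis
      using 1 by (auto simp: lebesgue_integral_eq_integral integral_unique)
  qed
  from int_on[of 1] show "(LINT x|mD. f x) = F 1 - F 0" "integrable mD f" by auto
  assume x: "0 < x" "x < 1"
  have "J f x = (LINT t|lebesgue. indicator {0<..<1} t *\<^sub>R (if t < x then f t else 0))"
    unfolding J_def by (subst integral_restrict_space) auto
  also have "\<dots> = (LINT t|lebesgue. indicator {0<..<x} t *\<^sub>R f t)"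
    by (intro Bochner_Integration.integral_cong) (use x in \<open>auto simp: indicator_def\<close>)
  also have "\<dots> = (LINT t|lebesgue_on {0<..<x}. f t)"
    by (subst integral_restrict_space) auto
  finally show "J f x = F x - F 0" using int_on[of x] x by simp
qed

lemma J_1: "0 < x \<Longrightarrow> x < 1 \<Longrightarrow> J (\<lambda>_. 1) x = of_real x"
  by (subst FTC_J[of of_real "\<lambda>_. 1"])
    (auto intro!: has_vector_derivative_of_real derivative_eq_intros simp: has_real_derivative_iff_has_vector_derivative[symmetric])

subsection \<open>Test functions and the fundamental lemma\<close>

definition smooth :: "(real \<Rightarrow> real) \<Rightarrow> bool" where
  "smooth f \<longleftrightarrow> (\<forall>k x. (deriv ^^ k) f differentiable (at x))"

text \<open>Avoids formulas for iterated derivatives: a class of differentiable functions that is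
  closed under one \<open>deriv\<close> contains all higher derivatives of its members.\<close>

lemma smooth_coinduct:
  assumes "f \<in> S" "\<And>g x. g \<in> S \<Longrightarrow> g differentiable (at x)" "\<And>g. g \<in> S \<Longrightarrow> deriv g \<in> S"
  shows "smooth f"
proof -
  have "(deriv ^^ k) f \<in> S" for k
    by (induction k) (use assms in auto)
  then show ?thesis using assms(2) by (auto simp: smooth_def)
qed

lemma smooth_differentiable: "smooth f \<Longrightarrow> f differentiable (at x)"
  unfolding smooth_def by (metis funpow_0)

lemma smooth_DERIV: "smooth f \<Longrightarrow> (f has_real_derivative deriv f x) (at x)"
  using smooth_differentiable DERIV_deriv_iff_real_differentiable by blast

lemma smooth_deriv: "smooth f \<Longrightarrow> smooth (deriv f)"
  unfolding smooth_def by (metis comp_apply funpow_Suc_right)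

lemma smooth_antiderivative:
  assumes "\<And>x. (F has_real_derivative f x) (at x)" "smooth f"
  shows "smooth F"
proof (rule smooth_coinduct[of F "insert F {g. smooth g}"])
  have "deriv F = f" using assms(1) by (auto intro!: DERIV_imp_deriv)
  then show "deriv g \<in> insert F {g. smooth g}" if "g \<in> insert F {g. smooth g}" for g
    using that assms(2) smooth_deriv by auto
  show "g differentiable at x" if "g \<in> insert F {g. smooth g}" for g x
    using that smooth_differentiable assms(1) real_differentiable_def by auto
qed simp

lemma smooth_continuous_on: "smooth f \<Longrightarrow> continuous_on S f"
  by (meson continuous_at_imp_continuous_on differentiable_imp_continuous_within smooth_differentiable)

text \<open>The algebra generated by smooth functions and their affine reparametrisations is closed
  under differentiation, so all of its members are smooth.\<close>

inductive_set smooth_algebra :: "(real \<Rightarrow> real) set" where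
  smooth_algebra_affine: "smooth f \<Longrightarrow> (\<lambda>x. f (a * x + b)) \<in> smooth_algebra"
| smooth_algebra_add: "f \<in> smooth_algebra \<Longrightarrow> g \<in> smooth_algebra \<Longrightarrow> (\<lambda>x. f x + g x) \<in> smooth_algebra"
| smooth_algebra_mult: "f \<in> smooth_algebra \<Longrightarrow> g \<in> smooth_algebra \<Longrightarrow> (\<lambda>x. f x * g x) \<in> smooth_algebra"

lemma smooth_const: "smooth (\<lambda>x. c)"
  by (rule smooth_coinduct[of _ "range (\<lambda>c x. c)"]) auto

lemma smooth_algebra_const: "(\<lambda>x. c) \<in> smooth_algebra"
  using smooth_algebra_affine[OF smooth_const[of c]] by simp

lemma smooth_algebra_deriv:
  assumes "f \<in> smooth_algebra"
  shows "\<exists>f'\<in>smooth_algebra. \<forall>x. (f has_real_derivative f' x) (at x)"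
  using assms
proof induction
  case (smooth_algebra_affine f a b)
  have "((\<lambda>x. f (a * x + b)) has_real_derivative deriv f (a * x + b) * a) (at x)" for x
    by (rule DERIV_chain2[OF smooth_DERIV[OF smooth_algebra_affine]])
       (auto intro!: derivative_eq_intros)
  moreover have "(\<lambda>x. deriv f (a * x + b) * a) \<in> smooth_algebra"
    by (intro smooth_algebra.intros smooth_algebra_const smooth_deriv smooth_algebra_affine)
  ultimately show ?case by (intro bexI[of _ "\<lambda>x. deriv f (a * x + b) * a"]) auto
next
  case (smooth_algebra_add f g)
  then obtain f' g' where *: "f' \<in> smooth_algebra" "g' \<in> smooth_algebra"
    "\<And>x. (f has_real_derivative f' x) (at x)" "\<And>x. (g has_real_derivative g' x) (at x)" by blast
  show ?case
    by (rule bexI[of _ "\<lambda>x. f' x + g' x"])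
       (use * in \<open>auto intro!: smooth_algebra.intros derivative_eq_intros\<close>)
next
  case (smooth_algebra_mult f g)
  then obtain f' g' where *: "f' \<in> smooth_algebra" "g' \<in> smooth_algebra"
    "\<And>x. (f has_real_derivative f' x) (at x)" "\<And>x. (g has_real_derivative g' x) (at x)" by blast
  show ?case
    by (rule bexI[of _ "\<lambda>x. f' x * g x + g' x * f x"])
       (use * smooth_algebra_mult in \<open>auto intro!: smooth_algebra.intros derivative_eq_intros\<close>)
qed

lemma smooth_algebra_smooth: "f \<in> smooth_algebra \<Longrightarrow> smooth f"
proof (erule smooth_coinduct)
  fix g assume g: "g \<in> smooth_algebra"
  then obtain g' where *: "g' \<in> smooth_algebra" "\<And>x. (g has_real_derivative g' x) (at x)"
    using smooth_algebra_deriv by blast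
  show "g differentiable at x" for x
    using * real_differentiable_def by blast
  have "deriv g = g'" using * by (auto intro!: DERIV_imp_deriv)
  with * show "deriv g \<in> smooth_algebra" by simp
qed

lemma smooth_imp_algebra: "smooth f \<Longrightarrow> f \<in> smooth_algebra"
  using smooth_algebra_affine[of f 1 0] by simp

lemma smooth_add: "smooth f \<Longrightarrow> smooth g \<Longrightarrow> smooth (\<lambda>x. f x + g x)"
  by (simp add: smooth_algebra_smooth smooth_algebra_add smooth_imp_algebra)

lemma smooth_mult: "smooth f \<Longrightarrow> smooth g \<Longrightarrow> smooth (\<lambda>x. f x * g x)"
  by (simp add: smooth_algebra_smooth smooth_algebra_mult smooth_imp_algebra)

lemma smooth_affine: "smooth f \<Longrightarrow> smooth (\<lambda>x. f (a * x + b))"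
  by (rule smooth_algebra_smooth) (rule smooth_algebra_affine)

section \<open>Flat functions\<close>

definition bump :: "real \<Rightarrow> nat \<Rightarrow> real \<Rightarrow> real" where
  "bump c n x = (if x > 0 then (1 / x) ^ n * exp (- c / x) else 0)"

text \<open>\<open>bump c 0\<close> is the classical flat function exp(-c/x), extended by 0. The
  powers of 1/x are there because differentiation leads from one member of the family to
  combinations of others. The parameter \<open>c\<close> later tends to 0, which turns bumps into
  step functions.\<close>

lemma bump_DERIV:
  assumes c: "c > 0"
  shows "(bump c n has_real_derivative c * bump c (n + 2) x - real n * bump c (n + 1) x) (at x)"
proof -
  consider "x > 0" | "x < 0" | "x = 0" by linarith
  then show ?thesis
  proof cases
    case 1
    have inv: "((\<lambda>x. 1 / x) has_real_derivative - ((1 / x)\<^sup>2)) (at x)"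
      using 1 by (auto intro!: derivative_eq_intros simp: power2_eq_square)
    have "((\<lambda>x. (1 / x) ^ n) has_real_derivative - (real n * (1 / x) ^ (n + 1))) (at x)"
    proof (cases n)
      case (Suc m)
      show ?thesis
        using DERIV_power_Suc[OF inv, of m] unfolding Suc
        by (rule DERIV_cong) (simp add: power2_eq_square algebra_simps)
    qed simp
    moreover have "((\<lambda>x. exp (- c / x)) has_real_derivative exp (- c / x) * (c * (1 / x)\<^sup>2)) (at x)"
      using 1 by (auto intro!: derivative_eq_intros simp: power2_eq_square)
    ultimately have "((\<lambda>x. (1 / x) ^ n * exp (- c / x)) has_real_derivative
        c * bump c (n + 2) x - real n * bump c (n + 1) x) (at x)"
      by (rule DERIV_cong[OF DERIV_mult])
        (use 1 in \<open>simp add: bump_def power2_eq_square algebra_simps\<close>)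
    then show ?thesis
      by (rule has_field_derivative_transform_within_open[of _ _ _ "{0<..}"]) (use 1 in \<open>auto simp: bump_def\<close>)
  next
    case 2
    have "((\<lambda>x. 0) has_real_derivative c * bump c (n + 2) x - real n * bump c (n + 1) x) (at x)"
      using 2 by (auto simp: bump_def)
    then show ?thesis
      by (rule has_field_derivative_transform_within_open[of _ _ _ "{..<0}"]) (use 2 in \<open>auto simp: bump_def\<close>)
  next
    case 3
    have "((\<lambda>h. bump c n h / h) \<longlongrightarrow> 0) (at_right 0)"
    proof (rule Lim_transform_eventually)
      show "((\<lambda>h. (1 / h) ^ Suc n * exp (- c / h)) \<longlongrightarrow> 0) (at_right 0)"
      proof -
        \<comment> \<open>With y = c / h tending to infinity, the difference quotient is a constant
          times y^(n+1) / exp y, and the exponential wins.\<close>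
        have "filterlim (\<lambda>h. c / h) at_top (at_right 0)"
          using c filterlim_tendsto_pos_mult_at_top[OF tendsto_const c filterlim_inverse_at_top_right]
          by (simp add: divide_inverse)
        then have "((\<lambda>h. (1 / c) ^ Suc n * ((c / h) ^ Suc n / exp (c / h))) \<longlongrightarrow> (1 / c) ^ Suc n * 0) (at_right 0)"
          by (intro tendsto_mult tendsto_const filterlim_compose[OF tendsto_power_div_exp_0])
        moreover have "(1 / c) ^ Suc n * ((c / h) ^ Suc n / exp (c / h)) = (1 / h) ^ Suc n * exp (- c / h)" for h
          using c by (simp only: exp_minus divide_inverse power_mult_distrib[symmetric] mult.assoc[symmetric]
              minus_mult_left[symmetric]) simp
        ultimately show ?thesis by simp
      qed
      show "\<forall>\<^sub>F h in at_right 0. (1 / h) ^ Suc n * exp (- c / h) = bump c n h / h"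
        by (auto simp: bump_def eventually_at_right_field intro!: exI[of _ 1])
    qed
    moreover have "((\<lambda>h. bump c n h / h) \<longlongrightarrow> 0) (at_left 0)"
      by (rule Lim_transform_eventually[of "\<lambda>_. 0"])
         (auto simp: bump_def eventually_at_left_field intro!: exI[of _ "-1"])
    ultimately have "((\<lambda>h. bump c n h / h) \<longlongrightarrow> 0) (at 0)"
      by (simp add: filterlim_split_at)
    then show ?thesis using 3 by (simp add: DERIV_def bump_def)
  qed
qed

text \<open>The combination rule has the shape of the derivative in \<open>bump_DERIV\<close>, so it
  alone yields closure under differentiation.\<close>

inductive_set bump_span :: "real \<Rightarrow> (real \<Rightarrow> real) set" for c where
  bump_span_base: "bump c n \<in> bump_span c"
| bump_span_comb: "f \<in> bump_span c \<Longrightarrow> g \<in> bump_span c \<Longrightarrow> (\<lambda>x. a * f x - b * g x) \<in> bump_span c"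

lemma bump_span_deriv:
  assumes "f \<in> bump_span c" "c > 0"
  shows "\<exists>f'\<in>bump_span c. \<forall>x. (f has_real_derivative f' x) (at x)"
  using assms
proof induction
  case (bump_span_base n)
  show ?case
    by (rule bexI[of _ "\<lambda>x. c * bump c (n + 2) x - real n * bump c (n + 1) x"])
       (intro allI bump_DERIV bump_span_base bump_span.intros)+
next
  case (bump_span_comb f g a b)
  then obtain f' g' where *: "f' \<in> bump_span c" "g' \<in> bump_span c"
    "\<And>x. (f has_real_derivative f' x) (at x)" "\<And>x. (g has_real_derivative g' x) (at x)" by blast
  show ?case
    by (rule bexI[of _ "\<lambda>x. a * f' x - b * g' x"])
       (use * in \<open>auto intro!: bump_span.intros derivative_eq_intros\<close>)
qed

lemma smooth_bump:
  assumes "c > 0"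
  shows "smooth (bump c n)"
proof (rule smooth_coinduct)
  show "bump c n \<in> bump_span c" by (rule bump_span_base)
  fix g assume g: "g \<in> bump_span c"
  then obtain g' where *: "g' \<in> bump_span c" "\<And>x. (g has_real_derivative g' x) (at x)"
    using bump_span_deriv assms by blast
  show "g differentiable at x" for x
    using * real_differentiable_def by blast
  have "deriv g = g'" using * by (auto intro!: DERIV_imp_deriv)
  with * show "deriv g \<in> bump_span c" by simp
qed

section \<open>Test functions, their supports and primitives\<close>

lemma test_function_iff:
  "test_function \<phi> \<longleftrightarrow> smooth \<phi> \<and> (\<exists>a b. 0 < a \<and> b < 1 \<and> (\<forall>x. x \<notin> {a..b} \<longrightarrow> \<phi> x = 0))"
proof (intro iffI conjI; (elim conjE exE)?)
  assume \<phi>: "test_function \<phi>"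
  then show "smooth \<phi>" by (simp add: test_function_def smooth_def)
  from \<phi> obtain K where K: "compact K" "K \<subseteq> {0<..<1}" "\<And>x. x \<notin> K \<Longrightarrow> \<phi> x = 0"
    by (auto simp: test_function_def)
  show "\<exists>a b. 0 < a \<and> b < 1 \<and> (\<forall>x. x \<notin> {a..b} \<longrightarrow> \<phi> x = 0)"
  proof (cases "K = {}")
    case True
    then show ?thesis using K(3) by (intro exI[of _ "1/2"]) auto
  next
    case False
    obtain a where a: "a \<in> K" "\<And>x. x \<in> K \<Longrightarrow> a \<le> x" using compact_attains_inf[OF K(1) False] by blast
    obtain b where b: "b \<in> K" "\<And>x. x \<in> K \<Longrightarrow> x \<le> b" using compact_attains_sup[OF K(1) False] by blast
    have "0 < a" "b < 1" using a(1) b(1) K(2) by auto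
    moreover have "\<phi> x = 0" if "x \<notin> {a..b}" for x using that a(2) b(2) K(3) by (meson atLeastAtMost_iff)
    ultimately show ?thesis by blast
  qed
next
  fix a b assume "smooth \<phi>" "0 < a" "b < 1" "\<forall>x. x \<notin> {a..b} \<longrightarrow> \<phi> x = 0"
  then show "test_function \<phi>"
    unfolding test_function_def smooth_def by (intro conjI exI[of _ "{a..b}"]) auto
qed

lemma test_function_eq_0: "test_function \<phi> \<Longrightarrow> x \<notin> {0<..<1} \<Longrightarrow> \<phi> x = 0"
  by (auto simp: test_function_def)

lemma test_function_smooth: "test_function \<phi> \<Longrightarrow> smooth \<phi>"
  by (simp add: test_function_iff)

lemma test_function_bump:
  assumes "c > 0" "0 < a" "b < 1"
  shows "test_function (\<lambda>x. bump c 0 (x - a) * bump c 0 (b - x))"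
proof -
  have "smooth (\<lambda>x. bump c 0 (x - a) * bump c 0 (b - x))"
    using smooth_affine[OF smooth_bump[OF assms(1)], of 0 1 "-a"]
      smooth_affine[OF smooth_bump[OF assms(1)], of 0 "-1" b]
    by (intro smooth_mult) auto
  moreover have "\<forall>x. x \<notin> {a..b} \<longrightarrow> bump c 0 (x - a) * bump c 0 (b - x) = 0"
    by (auto simp: bump_def)
  ultimately show ?thesis using assms unfolding test_function_iff by blast
qed

lemma test_function_add_cmult:
  assumes "test_function f" "test_function g"
  shows "test_function (\<lambda>x. f x + c * g x)"
proof -
  from assms obtain a b a' b' where *: "0 < a" "b < 1" "\<And>x. x \<notin> {a..b} \<Longrightarrow> f x = 0"
    "0 < a'" "b' < 1" "\<And>x. x \<notin> {a'..b'} \<Longrightarrow> g x = 0" unfolding test_function_iff by blast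
  moreover have "smooth (\<lambda>x. f x + c * g x)"
    using assms by (auto simp: test_function_iff intro!: smooth_add smooth_mult smooth_const)
  moreover have "f x + c * g x = 0" if "x \<notin> {min a a'..max b b'}" for x
    using *(3)[of x] *(6)[of x] that by (fastforce simp: not_le)
  ultimately show ?thesis unfolding test_function_iff
    using * by (intro conjI exI[of _ "min a a'"] exI[of _ "max b b'"]) auto
qed

lemma test_function_deriv:
  assumes "test_function \<phi>"
  shows "test_function (deriv \<phi>)"
proof -
  from assms obtain a b where *: "0 < a" "b < 1" "\<And>x. x \<notin> {a..b} \<Longrightarrow> \<phi> x = 0"
    unfolding test_function_iff by blast
  have "deriv \<phi> x = 0" if "x \<notin> {a..b}" for x
  proof (rule DERIV_imp_deriv, rule has_field_derivative_transform_within_open)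
    show "((\<lambda>x. 0) has_real_derivative 0) (at x)" by simp
    show "open (- {a..b})" "x \<in> - {a..b}" using that by auto
  qed (use * in auto)
  then show ?thesis using * smooth_deriv test_function_smooth[OF assms]
    unfolding test_function_iff by blast
qed

lemma test_function_measurable [measurable]: "test_function \<phi> \<Longrightarrow> \<phi> \<in> borel_measurable mD"
  by (intro continuous_imp_measurable_on_sets_lebesgue smooth_continuous_on test_function_smooth) auto

lemma test_function_bounded:
  assumes "test_function \<phi>"
  obtains M where "\<And>x. \<bar>\<phi> x\<bar> \<le> M"
proof -
  have "compact (\<phi> ` {0..1})"
    by (intro compact_continuous_image smooth_continuous_on test_function_smooth assms) auto
  then obtain M where M: "\<And>x. x \<in> {0..1} \<Longrightarrow> \<bar>\<phi> x\<bar> \<le> M"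
    using compact_imp_bounded bounded_iff by (metis imageI real_norm_def)
  have "\<bar>\<phi> x\<bar> \<le> M" for x
    using M[of x] M[of 0] test_function_eq_0[OF assms, of x] by (cases "x \<in> {0..1}") auto
  then show thesis by (rule that)
qed

lemma test_function_L2: "test_function \<phi> \<Longrightarrow> (\<lambda>x. complex_of_real (\<phi> x)) \<in> L2"
proof -
  assume \<phi>: "test_function \<phi>"
  obtain M where M: "\<And>x. \<bar>\<phi> x\<bar> \<le> M" using test_function_bounded[OF \<phi>] by blast
  have [measurable]: "\<phi> \<in> borel_measurable mD" using test_function_measurable[OF \<phi>] .
  show ?thesis by (rule L2_bounded[of _ M]) (use M in auto)
qed

lemma test_function_integrable_mult:
  fixes h :: "real \<Rightarrow> 'a::{banach,real_normed_algebra_1,second_countable_topology}"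
  assumes "test_function \<phi>" "integrable mD h"
  shows "integrable mD (\<lambda>x. h x * of_real (\<phi> x))"
proof -
  obtain M where M: "\<And>x. \<bar>\<phi> x\<bar> \<le> M" using test_function_bounded[OF assms(1)] by blast
  have [measurable]: "h \<in> borel_measurable mD" "\<phi> \<in> borel_measurable mD"
    using assms test_function_measurable by auto
  show ?thesis
  proof (rule Bochner_Integration.integrable_bound)
    show "integrable mD (\<lambda>x. M * norm (h x))" using assms by auto
    have "norm (h x * of_real (\<phi> x)) \<le> norm (M * norm (h x))" for x
    proof -
      have "norm (h x * of_real (\<phi> x)) \<le> norm (h x) * \<bar>\<phi> x\<bar>"
        using norm_mult_ineq[of "h x" "of_real (\<phi> x)"] by simp
      also have "\<dots> \<le> norm (h x) * M" by (intro mult_left_mono M) auto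
      also have "\<dots> \<le> norm (M * norm (h x))" by (simp add: mult.commute)
      finally show ?thesis .
    qed
    then show "AE x in mD. norm (h x * of_real (\<phi> x)) \<le> norm (M * norm (h x))" by simp
  qed measurable
qed

lemma test_function_FTC:
  assumes "test_function \<phi>"
  shows "(LINT x|mD. complex_of_real (deriv \<phi> x)) = 0"
    and "0 < x \<Longrightarrow> x < 1 \<Longrightarrow> J (\<lambda>x. complex_of_real (deriv \<phi> x)) x = of_real (\<phi> x)"
proof -
  have *: "((\<lambda>x. complex_of_real (\<phi> x)) has_vector_derivative of_real (deriv \<phi> x)) (at x)" for x
    using smooth_DERIV[OF test_function_smooth[OF assms]]
    by (intro has_vector_derivative_of_real)
       (simp add: has_real_derivative_iff_has_vector_derivative[symmetric])
  have c: "continuous_on {0..1} (\<lambda>x. complex_of_real (deriv \<phi> x))"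
    by (intro continuous_intros smooth_continuous_on smooth_deriv test_function_smooth assms)
  show "(LINT x|mD. complex_of_real (deriv \<phi> x)) = 0"
    using FTC_mD[OF * c] test_function_eq_0[OF assms, of 0] test_function_eq_0[OF assms, of 1] by simp
  show "0 < x \<Longrightarrow> x < 1 \<Longrightarrow> J (\<lambda>x. complex_of_real (deriv \<phi> x)) x = of_real (\<phi> x)"
    using FTC_J[OF * c] test_function_eq_0[OF assms, of 0] by simp
qed

text \<open>The primitive from the left is constant to the right of the support, and mean zero makes
  that constant 0.\<close>

lemma test_function_antiderivative:
  assumes \<eta>: "test_function \<eta>" and 0: "(LINT x|mD. complex_of_real (\<eta> x)) = 0"
  obtains \<Phi> where "test_function \<Phi>" "deriv \<Phi> = \<eta>"
proof -
  from \<eta> obtain a b where ab: "0 < a" "b < 1" "\<And>x. x \<notin> {a..b} \<Longrightarrow> \<eta> x = 0"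
    unfolding test_function_iff by blast
  \<comment> \<open>The base point -1 lies left of the support, so every \<open>x \<ge> a\<close> is
    interior to \<open>{-1..x+1}\<close> and the derivative within the interval is a full
    derivative.\<close>
  define \<Phi> where "\<Phi> x = integral {-1..x} \<eta>" for x
  have left: "\<Phi> x = 0" if "x < a" for x
  proof -
    have "integral {-1..x} \<eta> = integral {-1..x} (\<lambda>_. 0)"
      by (rule Henstock_Kurzweil_Integration.integral_cong) (use ab(3) that in auto)
    then show ?thesis by (simp add: \<Phi>_def)
  qed
  have D: "(\<Phi> has_real_derivative \<eta> x) (at x)" for x
  proof (cases "x < a")
    case True
    show ?thesis
      by (rule has_field_derivative_transform_within_open[of "\<lambda>_. 0" _ _ "{..<a}"])
         (use True left ab(3)[of x] in auto)
  next
    case False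
    have "((\<lambda>u. integral {-1..u} \<eta>) has_vector_derivative \<eta> x) (at x within {-1..x+1})"
      by (rule integral_has_vector_derivative)
         (use False ab in \<open>auto intro!: smooth_continuous_on test_function_smooth \<eta>\<close>)
    moreover have "at x within {-1..x+1} = at x"
      by (rule at_within_interior) (use False ab in auto)
    ultimately show ?thesis
      by (simp add: has_real_derivative_iff_has_vector_derivative \<Phi>_def[abs_def])
  qed
  have "((\<lambda>x. complex_of_real (\<Phi> x)) has_vector_derivative of_real (\<eta> x)) (at x)" for x
    using D by (intro has_vector_derivative_of_real)
       (simp add: has_real_derivative_iff_has_vector_derivative[symmetric])
  moreover have "continuous_on {0..1} (\<lambda>x. complex_of_real (\<eta> x))"
    by (intro continuous_intros smooth_continuous_on test_function_smooth \<eta>)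
  ultimately have \<Phi>1: "\<Phi> 1 = 0"
    using FTC_mD[of "\<lambda>x. complex_of_real (\<Phi> x)" "\<lambda>x. of_real (\<eta> x)"] 0 left[of 0] ab(1) by simp
  have "\<exists>c. \<forall>x\<in>{b<..}. \<Phi> x = c"
  proof (rule has_field_derivative_zero_constant)
    show "(\<Phi> has_real_derivative 0) (at x within {b<..})" if "x \<in> {b<..}" for x
      using D[of x] ab(3)[of x] that by (auto intro: DERIV_subset)
  qed auto
  with \<Phi>1 ab(2) have right: "\<Phi> x = 0" if "x > b" for x
    using that by auto
  have "smooth \<Phi>"
    by (rule smooth_antiderivative[OF D]) (rule test_function_smooth[OF \<eta>])
  moreover have "\<forall>x. x \<notin> {a..b} \<longrightarrow> \<Phi> x = 0" using left right by auto
  ultimately have "test_function \<Phi>" using ab(1,2) unfolding test_function_iff by blast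
  moreover have "deriv \<Phi> = \<eta>" using D by (auto intro!: DERIV_imp_deriv)
  ultimately show thesis by (rule that)
qed

section \<open>The fundamental lemma of the calculus of variations\<close>

lemma bump_tendsto_1:
  assumes "c \<longlonglongrightarrow> 0" "y \<longlonglongrightarrow> l" "l > 0"
  shows "(\<lambda>n. bump (c n) 0 (y n)) \<longlonglongrightarrow> 1"
proof (rule Lim_transform_eventually)
  have "(\<lambda>n. exp (- c n / y n)) \<longlonglongrightarrow> exp (- 0 / l)"
    using assms by (intro tendsto_intros) auto
  then show "(\<lambda>n. exp (- c n / y n)) \<longlonglongrightarrow> 1" by simp
  show "\<forall>\<^sub>F n in sequentially. exp (- c n / y n) = bump (c n) 0 (y n)"
    using order_tendstoD(1)[OF assms(2,3)] by eventually_elim (simp add: bump_def)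
qed

lemma bump_le_1: "c > 0 \<Longrightarrow> \<bar>bump c 0 x\<bar> \<le> 1"
  by (simp add: bump_def)

text \<open>As \<open>c\<close> tends to 0, a product of two opposite bumps converges pointwise to
  the indicator of an open interval while staying below 1, so dominated convergence with majorant
  |h| applies.\<close>

lemma integral_interval_eq_0:
  fixes h :: "real \<Rightarrow> real"
  assumes h: "integrable mD h" and 0: "\<And>\<phi>. test_function \<phi> \<Longrightarrow> (LINT x|mD. h x * \<phi> x) = 0"
  shows "(LINT x|mD. indicator {a<..<b} x * h x) = 0"
proof -
  define c where "c n = 1 / real (n + 2)" for n
  have c: "c n > 0" for n by (simp add: c_def)
  have c0: "c \<longlonglongrightarrow> 0"
    unfolding c_def by (rule LIMSEQ_ignore_initial_segment[OF lim_1_over_n])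
  \<comment> \<open>The \<open>max\<close> and \<open>min\<close> with \<open>c n\<close> push the
    support inside (0,1) even when \<open>{a<..<b}\<close> reaches the boundary or beyond; both
    corrections disappear in the limit.\<close>
  define \<phi> where "\<phi> n x = bump (c n) 0 (x - max a (c n)) * bump (c n) 0 (min b (1 - c n) - x)" for n x
  have \<phi>: "test_function (\<phi> n)" for n
    unfolding \<phi>_def by (rule test_function_bump) (use c[of n] in auto)
  have [measurable]: "h \<in> borel_measurable mD" "\<phi> n \<in> borel_measurable mD" for n
    using h test_function_measurable[OF \<phi>] by auto
  have "(\<lambda>n. LINT x|mD. h x * \<phi> n x) \<longlonglongrightarrow> (LINT x|mD. indicator {a<..<b} x * h x)"
  proof (rule integral_dominated_convergence)
    show "integrable mD (\<lambda>x. \<bar>h x\<bar>)" using h by simp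
    show "AE x in mD. (\<lambda>n. h x * \<phi> n x) \<longlonglongrightarrow> indicator {a<..<b} x * h x"
    proof (rule AE_mD_I)
      fix x :: real assume x: "0 < x" "x < 1"
      have "(\<lambda>n. \<phi> n x) \<longlonglongrightarrow> indicator {a<..<b} x"
      proof (cases "a < x \<and> x < b")
        case True
        have "(\<lambda>n. bump (c n) 0 (x - max a (c n))) \<longlonglongrightarrow> 1"
        proof (rule bump_tendsto_1[OF c0])
          show "(\<lambda>n. x - max a (c n)) \<longlonglongrightarrow> x - max a 0" by (intro tendsto_intros c0)
        qed (use True x in auto)
        moreover have "(\<lambda>n. bump (c n) 0 (min b (1 - c n) - x)) \<longlonglongrightarrow> 1"
        proof (rule bump_tendsto_1[OF c0])
          show "(\<lambda>n. min b (1 - c n) - x) \<longlonglongrightarrow> min b (1 - 0) - x" by (intro tendsto_intros c0)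
        qed (use True x in auto)
        ultimately have "(\<lambda>n. \<phi> n x) \<longlonglongrightarrow> 1 * 1"
          unfolding \<phi>_def by (intro tendsto_mult)
        then show ?thesis using True by simp
      next
        case False
        then have "\<phi> n x = 0" for n by (auto simp: \<phi>_def bump_def)
        then show ?thesis using False by simp
      qed
      from tendsto_mult[OF tendsto_const this, of "h x"]
      show "(\<lambda>n. h x * \<phi> n x) \<longlonglongrightarrow> indicator {a<..<b} x * h x" by (simp add: mult.commute)
    qed
    have "\<bar>h x * \<phi> n x\<bar> \<le> \<bar>h x\<bar>" for n x
    proof -
      have "\<bar>\<phi> n x\<bar> \<le> 1 * 1"
        unfolding \<phi>_def abs_mult by (intro mult_mono bump_le_1 c) auto
      from mult_left_mono[OF this, of "\<bar>h x\<bar>"] show ?thesis by (simp add: abs_mult)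
    qed
    then show "AE x in mD. norm (h x * \<phi> n x) \<le> \<bar>h x\<bar>" for n by simp
  qed measurable
  then show ?thesis using 0[OF \<phi>] LIMSEQ_unique[OF tendsto_const] by force
qed

lemma borel_set_mD: "A \<in> sets borel \<Longrightarrow> indicator A \<in> borel_measurable mD"
  for A :: "real set"
  using measurable_sets[OF ident_measurable_mD, of A]
  by (intro borel_measurable_indicator') (simp_all add: vimage_def Int_def conj_commute)

text \<open>Dynkin's argument: open intervals are stable under intersection and generate the Borel
  sets, and the sets over which \<open>h\<close> integrates to 0 are closed under complements and
  countable disjoint unions.\<close>

lemma integral_borel_eq_0:
  fixes h :: "real \<Rightarrow> real"
  assumes h: "integrable mD h" and 0: "\<And>\<phi>. test_function \<phi> \<Longrightarrow> (LINT x|mD. h x * \<phi> x) = 0"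
    and A: "A \<in> sets borel"
  shows "(LINT x|mD. indicator A x * h x) = 0"
proof -
  let ?G = "range (\<lambda>(a, b). {a<..<b::real})"
  have sets: "A \<in> sigma_sets UNIV ?G"
    using A unfolding borel_eq_box box_real(1)[abs_def] by simp
  have borel: "X \<in> sets borel" if "X \<in> sigma_sets UNIV ?G" for X
    using that unfolding borel_eq_box box_real(1)[abs_def] by simp
  have ind: "integrable mD (\<lambda>x. indicator X x * h x)" if "X \<in> sets borel" for X
  proof (rule Bochner_Integration.integrable_bound[OF h])
    show "(\<lambda>x. indicator X x * h x) \<in> borel_measurable mD"
      using h by (intro borel_measurable_times borel_set_mD that) auto
  qed (auto simp: indicator_def)
  have "Int_stable ?G"
  proof (safe intro!: Int_stableI)
    fix a b a' b' :: real
    show "{a<..<b} \<inter> {a'<..<b'} \<in> ?G"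
      by (rule image_eqI[of _ _ "(max a a', min b b')"]) auto
  qed
  moreover have "?G \<subseteq> Pow UNIV" by simp
  ultimately show ?thesis
    using sets
  proof (induction rule: sigma_sets_induct_disjoint)
    case (basic X)
    then obtain a b where "X = {a<..<b}" by auto
    then show ?case using integral_interval_eq_0[OF h 0] by simp
  next
    case (compl X)
    \<comment> \<open>Any open interval covering (0,1) makes the total integral an instance of the
      interval case.\<close>
    have "(LINT x|mD. h x) = (LINT x|mD. indicator {-1<..<2} x * h x)"
      by (rule Bochner_Integration.integral_cong) auto
    then have "(LINT x|mD. h x) = 0"
      using integral_interval_eq_0[OF h 0] by simp
    moreover have "(LINT x|mD. indicator (UNIV - X) x * h x) = (LINT x|mD. h x - indicator X x * h x)"
      by (rule Bochner_Integration.integral_cong) (auto simp: indicator_def)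
    ultimately show ?case
      using compl h ind[OF borel] by simp
  next
    case (union X)
    have meas: "X i \<inter> {0<..<1} \<in> sets mD" for i
    proof -
      have "X i \<in> sets lebesgue"
        using borel[OF subsetD[OF union(2) rangeI[of X i]]] by simp
      then show ?thesis by (auto simp: sets_restrict_space_iff)
    qed
    have eq: "(LINT x|mD. indicator Y x * h x) = (LINT x:(Y \<inter> {0<..<1})|mD. h x)" for Y
      unfolding set_lebesgue_integral_def
      by (rule Bochner_Integration.integral_cong) (auto simp: indicator_def)
    have "(LINT x|mD. indicator (\<Union>i. X i) x * h x) = (LINT x:(\<Union>i. X i \<inter> {0<..<1})|mD. h x)"
      unfolding eq by (simp only: UN_simps)
    also have "\<dots> = (\<Sum>i. LINT x:(X i \<inter> {0<..<1})|mD. h x)"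
    proof (rule lebesgue_integral_countable_add[OF meas])
      show "X i \<inter> {0<..<1} \<inter> (X j \<inter> {0<..<1}) = {}" if "i \<noteq> j" for i j
        using union(1) that by (auto simp: disjoint_family_on_def)
      have "(\<lambda>x. indicator (\<Union>i. X i \<inter> {0<..<1}) x *\<^sub>R h x) \<in> borel_measurable mD"
        using meas h by measurable
      then show "set_integrable mD (\<Union>i. X i \<inter> {0<..<1}) h"
        unfolding set_integrable_def
        by (rule Bochner_Integration.integrable_bound[OF h]) (auto simp: indicator_def)
    qed
    also have "\<dots> = 0" using union unfolding eq by simp
    finally show ?case .
  qed auto
qed

text \<open>The integral of \<open>h\<close> over the set where it is positive is 0, so that set is
  null; the same applies to \<open>- h\<close>.\<close>

lemma fundamental_lemma_real:
  fixes h :: "real \<Rightarrow> real"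
  assumes h: "integrable mD h" and 0: "\<And>\<phi>. test_function \<phi> \<Longrightarrow> (LINT x|mD. h x * \<phi> x) = 0"
  shows "AE x in mD. h x = 0"
proof -
  have nonpos: "AE x in mD. g x \<le> 0"
    if g: "integrable mD g" and g0: "\<And>\<phi>. test_function \<phi> \<Longrightarrow> (LINT x|mD. g x * \<phi> x) = 0"
    for g :: "real \<Rightarrow> real"
  proof -
    have [measurable]: "g \<in> borel_measurable mD" using g by auto
    define P where "P = {x \<in> space mD. g x > 0}"
    have "P \<in> sets mD" unfolding P_def by measurable
    then have "P \<in> sets lebesgue" by (auto simp: sets_restrict_space_iff)
    \<comment> \<open>The positivity set is only Lebesgue measurable, whereas the vanishing of
      integrals is known for Borel sets; the completion supplies a Borel set that differs from it by
      part of a null set.\<close>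
    then obtain A N N' where A: "P = A \<union> N" "N \<subseteq> N'" "N' \<in> null_sets lborel" "A \<in> sets lborel"
      by (rule sets_completionE)
    have [measurable]: "(indicator P :: real \<Rightarrow> real) \<in> borel_measurable mD"
      using \<open>P \<in> sets mD\<close> by simp
    have [measurable]: "(indicator A :: real \<Rightarrow> real) \<in> borel_measurable mD"
      using A(4) borel_set_mD by auto
    have "AE x in lebesgue. x \<notin> N'"
      using A(3) by (intro AE_not_in null_sets_completionI)
    then have "AE x in mD. x \<notin> N'"
      by (subst AE_restrict_space_iff) (auto elim: eventually_mono)
    then have ae: "AE x in mD. indicator P x * g x = indicator A x * g x"
      by eventually_elim (use A(1,2) in \<open>auto simp: indicator_def\<close>)
    have "(LINT x|mD. indicator P x * g x) = (LINT x|mD. indicator A x * g x)"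
      by (rule integral_cong_AE[OF _ _ ae]) measurable
    also have "\<dots> = 0" using integral_borel_eq_0[OF g g0, of A] A(4) by simp
    finally have "(LINT x|mD. indicator P x * g x) = 0" .
    moreover have "integrable mD (\<lambda>x. indicator P x * g x)"
      by (rule Bochner_Integration.integrable_bound[OF g]) (measurable, auto simp: indicator_def)
    ultimately have "AE x in mD. indicator P x * g x = 0"
      by (subst (asm) integral_nonneg_eq_0_iff_AE) (auto simp: P_def indicator_def)
    then show ?thesis
      using AE_space by eventually_elim (auto simp: P_def indicator_def split: if_splits)
  qed
  have "AE x in mD. h x \<le> 0" by (rule nonpos[OF h 0])
  moreover have "AE x in mD. - h x \<le> 0"
    by (rule nonpos) (use h 0 in auto)
  ultimately show ?thesis by eventually_elim auto
qed

lemma fundamental_lemma: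
  fixes h :: "real \<Rightarrow> complex"
  assumes h: "integrable mD h"
    and 0: "\<And>\<phi>. test_function \<phi> \<Longrightarrow> (LINT x|mD. h x * complex_of_real (\<phi> x)) = 0"
  shows "AE x in mD. h x = 0"
proof -
  have Re: "(LINT x|mD. Re (h x) * \<phi> x) = 0" and Im: "(LINT x|mD. Im (h x) * \<phi> x) = 0"
    if "test_function \<phi>" for \<phi>
  proof -
    note int = test_function_integrable_mult[OF that h]
    show "(LINT x|mD. Re (h x) * \<phi> x) = 0" "(LINT x|mD. Im (h x) * \<phi> x) = 0"
      using integral_Re[OF int] integral_Im[OF int] 0[OF that] by simp_all
  qed
  have "AE x in mD. Re (h x) = 0" by (rule fundamental_lemma_real) (use h Re in auto)
  moreover have "AE x in mD. Im (h x) = 0" by (rule fundamental_lemma_real) (use h Im in auto)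
  ultimately show ?thesis by eventually_elim (simp add: complex_eq_iff)
qed

section \<open>Functions with vanishing weak derivatives\<close>

lemma not_AE_mD_False: "\<not> (AE x in mD. False)"
proof
  assume "AE x in mD. False"
  then have "(LINT x|mD. 1 :: real) = 0"
    by (intro integral_eq_zero_AE) auto
  then show False using measure_mD_space by simp
qed

text \<open>No bump has to be integrated explicitly: if all test functions had mean 0, the
  fundamental lemma applied to the constant 1 would give 1 = 0 almost everywhere.\<close>

lemma test_function_normalized:
  obtains \<psi> where "test_function \<psi>" "(LINT x|mD. complex_of_real (\<psi> x)) = 1"
proof -
  have "\<exists>\<psi>. test_function \<psi> \<and> (LINT x|mD. \<psi> x) \<noteq> 0"
  proof (rule ccontr)
    assume "\<nexists>\<psi>. test_function \<psi> \<and> (LINT x|mD. \<psi> x) \<noteq> 0"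
    then have "AE x in mD. (1 :: real) = 0"
      by (intro fundamental_lemma_real) auto
    then show False using not_AE_mD_False by simp
  qed
  then obtain \<psi> where \<psi>: "test_function \<psi>" "(LINT x|mD. \<psi> x) \<noteq> 0" by blast
  \<comment> \<open>Division by the integral, written as f + c f so that the closure lemma for sums
    covers it.\<close>
  have "test_function (\<lambda>x. \<psi> x + (1 / (LINT x|mD. \<psi> x) - 1) * \<psi> x)"
    by (intro test_function_add_cmult \<psi>(1))
  moreover have "(\<lambda>x. \<psi> x + (1 / (LINT x|mD. \<psi> x) - 1) * \<psi> x) = (\<lambda>x. \<psi> x / (LINT x|mD. \<psi> x))"
    by (auto simp: algebra_simps)
  ultimately show thesis
    using \<psi>(2) by (intro that[of "\<lambda>x. \<psi> x / (LINT x|mD. \<psi> x)"]) auto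
qed

text \<open>The du Bois-Reymond lemma. Subtracting from \<eta> its mean times a normalized \<psi>
  leaves a function of mean 0, hence the derivative of a test function, to which \<open>z\<close> is
  orthogonal. The constant is therefore the integral of z \<psi>.\<close>

lemma weak_deriv_zero_const:
  assumes z: "integrable mD z"
    and 0: "\<And>\<phi>. test_function \<phi> \<Longrightarrow> (LINT x|mD. z x * complex_of_real (deriv \<phi> x)) = 0"
  shows "\<exists>c. AE x in mD. z x = c"
proof -
  obtain \<psi> where \<psi>: "test_function \<psi>" "(LINT x|mD. complex_of_real (\<psi> x)) = 1"
    using test_function_normalized .
  note int = test_function_integrable_mult[OF _ z]
  note int1 = L2_integrable[OF test_function_L2]
  define c where "c = (LINT x|mD. z x * complex_of_real (\<psi> x))"
  have "AE x in mD. z x - c = 0"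
  proof (rule fundamental_lemma)
    show "integrable mD (\<lambda>x. z x - c)" using z by simp
    fix \<eta> assume \<eta>: "test_function \<eta>"
    let ?m = "LINT x|mD. \<eta> x"
    have t: "test_function (\<lambda>x. \<eta> x + (- ?m) * \<psi> x)"
      by (intro test_function_add_cmult \<eta> \<psi>)
    moreover have "(LINT x|mD. complex_of_real (\<eta> x + (- ?m) * \<psi> x)) = 0"
      using int1[OF \<eta>] int1[OF \<psi>(1)] \<psi>(2) by simp
    ultimately obtain \<Phi> where "test_function \<Phi>" "deriv \<Phi> = (\<lambda>x. \<eta> x + (- ?m) * \<psi> x)"
      using test_function_antiderivative by blast
    from 0[OF this(1)] this(2)
    have "0 = (LINT x|mD. z x * complex_of_real (\<eta> x + (- ?m) * \<psi> x))" by simp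
    also have "\<dots> = (LINT x|mD. z x * complex_of_real (\<eta> x) - of_real ?m * (z x * complex_of_real (\<psi> x)))"
      by (simp add: algebra_simps)
    also have "\<dots> = (LINT x|mD. z x * complex_of_real (\<eta> x)) - of_real ?m * c"
      using int[OF \<eta>] int[OF \<psi>(1)] by (simp add: c_def)
    also have "of_real ?m * c = (LINT x|mD. c * complex_of_real (\<eta> x))"
      by simp
    also have "(LINT x|mD. z x * complex_of_real (\<eta> x)) - (LINT x|mD. c * complex_of_real (\<eta> x))
        = (LINT x|mD. (z x - c) * complex_of_real (\<eta> x))"
      using int[OF \<eta>] int1[OF \<eta>]
      by (subst Bochner_Integration.integral_diff[symmetric]) (auto simp: algebra_simps)
    finally show "(LINT x|mD. (z x - c) * complex_of_real (\<eta> x)) = 0" by simp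
  qed
  then show ?thesis by (intro exI[of _ c]) simp
qed

subsection \<open>Weak derivatives\<close>

lemma ident_integrable_mD: "integrable mD (\<lambda>x. complex_of_real x)"
  by (rule integrable_mD_bounded[of _ 1]) auto

text \<open>Integration by parts without absolute continuity: this is Fubini on the triangle, where
  the product term drops out because \<open>deriv \<phi>\<close> has mean 0.\<close>

lemma weak_deriv_J:
  assumes h: "integrable mD h" and \<phi>: "test_function \<phi>"
  shows "(LINT x|mD. J h x * complex_of_real (deriv \<phi> x)) = - (LINT x|mD. h x * complex_of_real (\<phi> x))"
proof -
  note int = L2_integrable[OF test_function_L2]
  have "(LINT x|mD. J h x * complex_of_real (deriv \<phi> x))
      = - (LINT x|mD. h x * J (\<lambda>x. complex_of_real (deriv \<phi> x)) x)"
    using integral_J_mult[OF h int[OF test_function_deriv[OF \<phi>]]] test_function_FTC(1)[OF \<phi>] by simp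
  also have "(LINT x|mD. h x * J (\<lambda>x. complex_of_real (deriv \<phi> x)) x) = (LINT x|mD. h x * complex_of_real (\<phi> x))"
    by (rule Bochner_Integration.integral_cong) (use test_function_FTC(2)[OF \<phi>] in auto)
  finally show ?thesis .
qed

text \<open>A first weak derivative of \<open>z\<close> is not known to exist as a function, so the
  first-order lemma cannot simply be used twice. The mean-zero correction by \<psi> shows instead
  that \<open>z\<close> has the constant weak derivative \<open>- c\<close>, and the first-order
  lemma applies to z + c x.\<close>

lemma weak_deriv2_zero_affine:
  assumes z: "integrable mD z"
    and 0: "\<And>\<phi>. test_function \<phi> \<Longrightarrow> (LINT x|mD. z x * complex_of_real (deriv (deriv \<phi>) x)) = 0"
  shows "\<exists>a b. AE x in mD. z x = a + b * of_real x"
proof -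
  obtain \<psi> where \<psi>: "test_function \<psi>" "(LINT x|mD. complex_of_real (\<psi> x)) = 1"
    using test_function_normalized .
  note int = test_function_integrable_mult[OF _ z]
  note int1 = L2_integrable[OF test_function_L2]
  define c where "c = (LINT x|mD. z x * complex_of_real (deriv \<psi> x))"
  have "\<exists>a. AE x in mD. z x + c * of_real x = a"
  proof (rule weak_deriv_zero_const)
    show "integrable mD (\<lambda>x. z x + c * of_real x)" using z ident_integrable_mD by simp
    fix \<eta> assume \<eta>: "test_function \<eta>"
    let ?m = "LINT x|mD. \<eta> x"
    have t: "test_function (\<lambda>x. \<eta> x + (- ?m) * \<psi> x)"
      by (intro test_function_add_cmult \<eta> \<psi>)
    moreover have "(LINT x|mD. complex_of_real (\<eta> x + (- ?m) * \<psi> x)) = 0"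
      using int1[OF \<eta>] int1[OF \<psi>(1)] \<psi>(2) by simp
    ultimately obtain \<Phi> where \<Phi>: "test_function \<Phi>" "deriv \<Phi> = (\<lambda>x. \<eta> x + (- ?m) * \<psi> x)"
      using test_function_antiderivative by blast
    have "deriv (deriv \<Phi>) x = deriv \<eta> x - ?m * deriv \<psi> x" for x
      unfolding \<Phi>(2)
      by (rule DERIV_imp_deriv)
         (auto intro!: derivative_eq_intros smooth_DERIV test_function_smooth \<eta> \<psi>)
    with 0[OF \<Phi>(1)]
    have "0 = (LINT x|mD. z x * complex_of_real (deriv \<eta> x - ?m * deriv \<psi> x))" by simp
    also have "\<dots> = (LINT x|mD. z x * complex_of_real (deriv \<eta> x) - of_real ?m * (z x * complex_of_real (deriv \<psi> x)))"
      by (simp add: algebra_simps)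
    also have "\<dots> = (LINT x|mD. z x * complex_of_real (deriv \<eta> x)) - of_real ?m * c"
      using int[OF test_function_deriv[OF \<eta>]] int[OF test_function_deriv[OF \<psi>(1)]] by (simp add: c_def)
    finally have 1: "(LINT x|mD. z x * complex_of_real (deriv \<eta> x)) = of_real ?m * c" by simp
    have "(LINT x|mD. complex_of_real x * complex_of_real (deriv \<eta> x))
        = (LINT x|mD. J (\<lambda>_. 1) x * complex_of_real (deriv \<eta> x))"
      by (rule Bochner_Integration.integral_cong) (auto simp: J_1)
    also have "\<dots> = - of_real ?m"
      by (subst weak_deriv_J[OF _ \<eta>]) auto
    finally have 2: "(LINT x|mD. complex_of_real x * complex_of_real (deriv \<eta> x)) = - of_real ?m" .
    have "(LINT x|mD. (z x + c * of_real x) * complex_of_real (deriv \<eta> x))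
        = (LINT x|mD. z x * complex_of_real (deriv \<eta> x) + c * (complex_of_real x * complex_of_real (deriv \<eta> x)))"
      by (simp add: algebra_simps)
    also have "\<dots> = (LINT x|mD. z x * complex_of_real (deriv \<eta> x))
        + (LINT x|mD. c * (complex_of_real x * complex_of_real (deriv \<eta> x)))"
      by (intro Bochner_Integration.integral_add int integrable_mult_right test_function_deriv \<eta>
          test_function_integrable_mult[OF _ ident_integrable_mD])
    also have "\<dots> = 0"
      unfolding 1 Bochner_Integration.integral_mult_right_zero 2 by simp
    finally show "(LINT x|mD. (z x + c * of_real x) * complex_of_real (deriv \<eta> x)) = 0" .
  qed
  then obtain a where "AE x in mD. z x + c * of_real x = a" by blast
  then have "AE x in mD. z x = a + (- c) * of_real x"
    by eventually_elim (simp add: algebra_simps add_eq_0_iff)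
  then show ?thesis by blast
qed

lemma weak_deriv_integral:
  assumes g: "integrable mD g" and \<phi>: "test_function \<phi>"
  shows "(LINT x|mD. (a + b * of_real x + J (J g) x) * complex_of_real (deriv \<phi> x))
      = - (LINT x|mD. (b + J g x) * complex_of_real (\<phi> x))"
    and "(LINT x|mD. (a + b * of_real x + J (J g) x) * complex_of_real (deriv (deriv \<phi>) x))
      = (LINT x|mD. g x * complex_of_real (\<phi> x))"
proof -
  \<comment> \<open>Stated for arbitrary \<open>g\<close> and \<open>\<phi>\<close> because the
    second identity uses it with \<open>deriv \<phi>\<close> as the test function.\<close>
  have one: "(LINT x|mD. (a + b * of_real x + J (J g) x) * complex_of_real (deriv \<phi> x))
      = - (LINT x|mD. (b + J g x) * complex_of_real (\<phi> x))"
    if g: "integrable mD g" and \<phi>: "test_function \<phi>" for g \<phi>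
  proof -
    have int: "integrable mD (\<lambda>x. b + J g x)" using J_integrable[OF g] by simp
    have int': "integrable mD (\<lambda>x. complex_of_real (deriv \<phi> x))"
      by (intro L2_integrable test_function_L2 test_function_deriv \<phi>)
    have "(LINT x|mD. (a + b * of_real x + J (J g) x) * complex_of_real (deriv \<phi> x))
      = (LINT x|mD. a * complex_of_real (deriv \<phi> x) + J (\<lambda>x. b + J g x) x * complex_of_real (deriv \<phi> x))"
    proof (rule Bochner_Integration.integral_cong)
      fix x assume "x \<in> space mD"
      then have "J (\<lambda>x. b + J g x) x = b * of_real x + J (J g) x"
        using J_add[of "\<lambda>_. b" "J g" x] J_integrable[OF g] J_cmult[of b "\<lambda>_. 1" x] J_1[of x] by simp
      then show "(a + b * of_real x + J (J g) x) * complex_of_real (deriv \<phi> x)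
        = a * complex_of_real (deriv \<phi> x) + J (\<lambda>x. b + J g x) x * complex_of_real (deriv \<phi> x)"
        by (simp add: algebra_simps)
    qed simp
    also have "\<dots> = (LINT x|mD. a * complex_of_real (deriv \<phi> x)) + (LINT x|mD. J (\<lambda>x. b + J g x) x * complex_of_real (deriv \<phi> x))"
      by (intro Bochner_Integration.integral_add integrable_mult_right int'
          test_function_integrable_mult test_function_deriv \<phi> J_integrable int)
    also have "\<dots> = - (LINT x|mD. (b + J g x) * complex_of_real (\<phi> x))"
      unfolding Bochner_Integration.integral_mult_right_zero test_function_FTC(1)[OF \<phi>] weak_deriv_J[OF int \<phi>] by simp
    finally show ?thesis .
  qed
  then show "(LINT x|mD. (a + b * of_real x + J (J g) x) * complex_of_real (deriv \<phi> x))
      = - (LINT x|mD. (b + J g x) * complex_of_real (\<phi> x))"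
    using g \<phi> by blast
  have "(LINT x|mD. (b + J g x) * complex_of_real (deriv \<phi> x))
      = (LINT x|mD. b * complex_of_real (deriv \<phi> x)) + (LINT x|mD. J g x * complex_of_real (deriv \<phi> x))"
    unfolding distrib_right
    by (intro Bochner_Integration.integral_add integrable_mult_right L2_integrable[OF test_function_L2]
          test_function_integrable_mult test_function_deriv \<phi> J_integrable g)
  also have "\<dots> = - (LINT x|mD. g x * complex_of_real (\<phi> x))"
    unfolding Bochner_Integration.integral_mult_right_zero test_function_FTC(1)[OF \<phi>] weak_deriv_J[OF g \<phi>] by simp
  finally show "(LINT x|mD. (a + b * of_real x + J (J g) x) * complex_of_real (deriv (deriv \<phi>) x))
      = (LINT x|mD. g x * complex_of_real (\<phi> x))"
    using one[OF g test_function_deriv[OF \<phi>]] by simp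
qed

lemma has_weak_deriv2_AE_unique:
  assumes "has_weak_deriv 2 u v" "has_weak_deriv 2 u w" "integrable mD v" "integrable mD w"
  shows "AE x in mD. v x = w x"
proof -
  have "AE x in mD. v x - w x = 0"
  proof (rule fundamental_lemma)
    fix \<phi> assume \<phi>: "test_function \<phi>"
    have "(LINT x|mD. (v x - w x) * complex_of_real (\<phi> x))
        = (LINT x|mD. v x * complex_of_real (\<phi> x)) - (LINT x|mD. w x * complex_of_real (\<phi> x))"
      unfolding left_diff_distrib
      by (intro Bochner_Integration.integral_diff test_function_integrable_mult \<phi> assms)
    also have "\<dots> = 0"
      using assms(1,2) \<phi> by (simp add: has_weak_deriv_def)
    finally show "(LINT x|mD. (v x - w x) * complex_of_real (\<phi> x)) = 0" .
  qed (use assms in auto)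
  then show ?thesis by simp
qed

lemma H2_wderiv2:
  assumes "u \<in> H2"
  shows "wderiv2 u \<in> L2" "has_weak_deriv 2 u (wderiv2 u)"
proof -
  have "\<exists>v. v \<in> L2 \<and> has_weak_deriv 2 u v" using assms by (auto simp: H2_def)
  from someI_ex[OF this] show "wderiv2 u \<in> L2" "has_weak_deriv 2 u (wderiv2 u)"
    by (auto simp: wderiv2_def)
qed

lemma H2_L2: "u \<in> H2 \<Longrightarrow> u \<in> L2"
  by (simp add: H2_def)

text \<open>\<open>J (J (wderiv2 u))\<close> has the same second weak derivative as
  \<open>u\<close>, so the difference is affine.\<close>

lemma H2_representation:
  assumes u: "u \<in> H2"
  shows "\<exists>a b. AE x in mD. u x = a + b * of_real x + J (J (wderiv2 u)) x"
proof -
  define g where "g = wderiv2 u"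
  have g: "integrable mD g" using H2_wderiv2(1)[OF u] by (simp add: g_def L2_integrable)
  have ui: "integrable mD u" using u by (simp add: H2_L2 L2_integrable)
  have "\<exists>a b. AE x in mD. u x - J (J g) x = a + b * of_real x"
  proof (rule weak_deriv2_zero_affine)
    show "integrable mD (\<lambda>x. u x - J (J g) x)"
      using ui g by (simp add: J_integrable)
    fix \<phi> assume \<phi>: "test_function \<phi>"
    note \<phi>2 = test_function_deriv[OF test_function_deriv[OF \<phi>]]
    have "(LINT x|mD. (u x - J (J g) x) * complex_of_real (deriv (deriv \<phi>) x))
        = (LINT x|mD. u x * complex_of_real (deriv (deriv \<phi>) x))
          - (LINT x|mD. J (J g) x * complex_of_real (deriv (deriv \<phi>) x))"
      unfolding left_diff_distrib
      by (intro Bochner_Integration.integral_diff test_function_integrable_mult \<phi>2 ui J_integrable g)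
    also have "\<dots> = 0"
      using weak_deriv_integral(2)[OF g \<phi>, of 0 0] H2_wderiv2(2)[OF u] \<phi>
      by (simp add: has_weak_deriv_def g_def numeral_2_eq_2)
    finally show "(LINT x|mD. (u x - J (J g) x) * complex_of_real (deriv (deriv \<phi>) x)) = 0" .
  qed
  then obtain a b where "AE x in mD. u x - J (J g) x = a + b * of_real x" by blast
  then have "AE x in mD. u x = a + b * of_real x + J (J g) x"
    by eventually_elim (simp add: algebra_simps)
  then show ?thesis unfolding g_def by blast
qed

text \<open>The converse of \<open>H2_representation\<close>. Since \<open>wderiv2\<close> is a
  choice, it can be identified only up to null sets, through uniqueness of weak derivatives.\<close>

lemma H2_I:
  assumes g: "g \<in> L2" and u: "u \<in> borel_measurable mD"
    and eq: "AE x in mD. u x = a + b * of_real x + J (J g) x"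
  shows "u \<in> H2" "AE x in mD. wderiv2 u x = g x"
proof -
  have gi: "integrable mD g" by (rule L2_integrable[OF g])
  have [measurable]: "u \<in> borel_measurable mD" "g \<in> borel_measurable mD"
    using u g by (auto simp: L2_def)
  have ident: "(\<lambda>x. complex_of_real x) \<in> L2" by (rule L2_bounded[of _ 1]) auto
  have uL2: "u \<in> L2"
    by (rule L2_AE_cong[OF _ u eq]) (intro L2_add L2_const L2_cmult ident J_L2 J_integrable gi)
  have cong: "(LINT x|mD. u x * complex_of_real (\<phi> x))
      = (LINT x|mD. (a + b * of_real x + J (J g) x) * complex_of_real (\<phi> x))"
    if "test_function \<phi>" for \<phi>
  proof -
    have [measurable]: "\<phi> \<in> borel_measurable mD" using test_function_measurable[OF that] .
    show ?thesis
      by (rule integral_cong_AE) (measurable, use eq in \<open>auto elim: eventually_mono\<close>)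
  qed
  have "has_weak_deriv 1 u (\<lambda>x. b + J g x)"
    unfolding has_weak_deriv_def
    using weak_deriv_integral(1)[OF gi] cong test_function_deriv by simp
  moreover have "(\<lambda>x. b + J g x) \<in> L2" by (intro L2_add L2_const J_L2 gi)
  moreover have w2: "has_weak_deriv 2 u g"
    unfolding has_weak_deriv_def
    using weak_deriv_integral(2)[OF gi] cong test_function_deriv by (simp add: numeral_2_eq_2)
  ultimately show "u \<in> H2" using uL2 g by (auto simp: H2_def)
  then show "AE x in mD. wderiv2 u x = g x"
    using H2_wderiv2 w2 g by (intro has_weak_deriv2_AE_unique[of u] L2_integrable) auto
qed

text \<open>The one-dimensional Sobolev embedding. It puts the nonlinear terms, the products
  \<open>cnj u1 * u2\<close> and \<open>u1\<^sup>2\<close>, into \<open>L2\<close>.\<close>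

lemma H2_AE_bounded:
  assumes u: "u \<in> H2"
  shows "\<exists>M. AE x in mD. cmod (u x) \<le> M"
proof -
  obtain a b where "AE x in mD. u x = a + b * of_real x + J (J (wderiv2 u)) x"
    using H2_representation[OF u] by blast
  then have "AE x in mD. cmod (u x) \<le> cmod a + cmod b + (LINT x|mD. cmod (J (wderiv2 u) x))"
    using AE_space
  proof eventually_elim
    case (elim x)
    have "cmod (J (J (wderiv2 u)) x) \<le> (LINT x|mD. cmod (J (wderiv2 u) x))"
      by (intro norm_J_bound J_integrable L2_integrable H2_wderiv2 u)
    moreover have "cmod (b * of_real x) \<le> cmod b"
      using elim(2) by (auto simp: norm_mult mult_left_le)
    ultimately show ?case
      unfolding elim(1)
      using norm_triangle_ineq[of "a + b * of_real x" "J (J (wderiv2 u)) x"] norm_triangle_ineq[of a "b * of_real x"]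
      by linarith
  qed
  then show ?thesis by blast
qed

subsection \<open>Volterra equations\<close>

text \<open>The bound holds at every point of (0,1), not just almost everywhere, so that Picard
  iterates converge pointwise and the integral equations hold at every point.\<close>

definition bounded_measurable :: "(real \<Rightarrow> complex) \<Rightarrow> bool" where
  "bounded_measurable f \<longleftrightarrow> f \<in> borel_measurable mD \<and> (\<exists>M. \<forall>x\<in>{0<..<1}. cmod (f x) \<le> M)"

lemma bounded_measurable_measurable: "bounded_measurable f \<Longrightarrow> f \<in> borel_measurable mD"
  by (simp add: bounded_measurable_def)

lemma bounded_measurable_L2: "bounded_measurable f \<Longrightarrow> f \<in> L2"
  by (auto simp: bounded_measurable_def intro: L2_bounded)

lemma bounded_measurable_integrable: "bounded_measurable f \<Longrightarrow> integrable mD f"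
  by (intro L2_integrable bounded_measurable_L2)

lemma bounded_measurable_add:
  assumes "bounded_measurable f" "bounded_measurable g"
  shows "bounded_measurable (\<lambda>x. f x + g x)"
proof -
  obtain M N where "\<forall>x\<in>{0<..<1}. cmod (f x) \<le> M" "\<forall>x\<in>{0<..<1}. cmod (g x) \<le> N"
    using assms by (auto simp: bounded_measurable_def)
  then have "\<forall>x\<in>{0<..<1}. cmod (f x + g x) \<le> M + N"
    by (meson add_mono norm_triangle_le)
  with assms show ?thesis by (auto simp: bounded_measurable_def)
qed

lemma bounded_measurable_J: "integrable mD h \<Longrightarrow> bounded_measurable (J h)"
  unfolding bounded_measurable_def
  by (intro conjI exI[of _ "LINT t|mD. cmod (h t)"] ballI norm_J_bound J_measurable) auto

text \<open>Integrating the weight exp(l x) gains a factor 1/l. Two applications of \<open>J\<close>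
  gain its square, which is the source of the contraction below.\<close>

lemma norm_J_exp_bound:
  assumes h: "integrable mD h" and le: "AE x in mD. cmod (h x) \<le> M * exp (l * x)"
    and "l > 0" "M \<ge> 0" and x: "x \<in> {0<..<1}"
  shows "cmod (J h x) \<le> M / l * exp (l * x)"
proof -
  let ?e = "\<lambda>t. M * exp (l * t)"
  have D: "((\<lambda>t. complex_of_real (M / l * exp (l * t))) has_vector_derivative of_real (?e t)) (at t)" for t
    using \<open>l > 0\<close>
    by (intro has_vector_derivative_of_real)
       (auto simp: has_real_derivative_iff_has_vector_derivative[symmetric] intro!: derivative_eq_intros)
  have cont: "continuous_on {0..1} (\<lambda>t. complex_of_real (?e t))"
    by (intro continuous_intros)
  have ei: "integrable mD ?e"
    using integrable_Re[OF FTC_integrable[OF D cont]] by simp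
  have "cmod (J h x) \<le> (LINT t|mD. (if t < x then cmod (h t) else 0))"
    by (rule norm_J_le[OF h])
  also have "\<dots> \<le> (LINT t|mD. (if t < x then ?e t else 0))"
    using h ei le by (intro integral_mono_AE J_integrand) (auto elim: eventually_mono)
  also have "\<dots> = M / l * exp (l * x) - M / l"
  proof -
    have "complex_of_real (LINT t|mD. (if t < x then ?e t else 0)) = J (\<lambda>t. of_real (?e t)) x"
      unfolding J_def integral_complex_of_real[symmetric]
      by (rule Bochner_Integration.integral_cong) auto
    also have "\<dots> = of_real (M / l * exp (l * x) - M / l)"
      using FTC_J[OF D cont, of x] x by simp
    finally show ?thesis by (simp only: of_real_eq_iff)
  qed
  also have "\<dots> \<le> M / l * exp (l * x)" using assms by simp
  finally show ?thesis .
qed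

text \<open>Picard iteration: in the weighted norm \<open>sup |f x| exp (- l x)\<close> with \<open>l\<close> large the map is a
  contraction.\<close>

lemma volterra_equation:
  fixes \<Psi> :: "(real \<Rightarrow> complex) \<Rightarrow> real \<Rightarrow> complex"
  assumes int: "\<And>f. bounded_measurable f \<Longrightarrow> integrable mD (\<Psi> f)"
    and L: "L \<ge> 0"
    and lip: "\<And>f g M l. \<lbrakk>bounded_measurable f; bounded_measurable g; M \<ge> 0; l \<ge> 1;
        \<And>x. x \<in> {0<..<1} \<Longrightarrow> cmod (f x - g x) \<le> M * exp (l * x)\<rbrakk>
        \<Longrightarrow> AE x in mD. cmod (\<Psi> f x - \<Psi> g x) \<le> L * M * exp (l * x)"
    and F: "bounded_measurable F"
  shows "\<exists>f. bounded_measurable f \<and> (\<forall>x\<in>{0<..<1}. f x = F x + J (J (\<Psi> f)) x)"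
proof -
  \<comment> \<open>Large enough that \<open>L / l\<^sup>2 \<le> 1 / 2\<close>, so the double
    integral halves weighted distances whatever the size of \<open>L\<close>.\<close>
  define l where "l = 2 * (L + 1)"
  have l: "l \<ge> 1" "l > 0" using L by (auto simp: l_def)
  have "2 * L \<le> l * 1" using L by (simp add: l_def)
  also have "\<dots> \<le> l * l" using l by (intro mult_left_mono) auto
  finally have Ll: "L / l / l \<le> 1 / 2" using l by (simp add: field_simps)
  define S where "S f = J (J (\<Psi> f))" for f
  have S_bm: "bounded_measurable (S f)" if "bounded_measurable f" for f
    unfolding S_def by (intro bounded_measurable_J J_integrable int that)
  have contr: "cmod (S f x - S g x) \<le> M / 2 * exp (l * x)"
    if f: "bounded_measurable f" and g: "bounded_measurable g" and M: "M \<ge> 0"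
      and fg: "\<And>x. x \<in> {0<..<1} \<Longrightarrow> cmod (f x - g x) \<le> M * exp (l * x)" and x: "x \<in> {0<..<1}" for f g M x
  proof -
    have i: "integrable mD (\<lambda>x. \<Psi> f x - \<Psi> g x)" using int f g by simp
    have "cmod (J (\<lambda>x. \<Psi> f x - \<Psi> g x) x) \<le> L * M / l * exp (l * x)" if "x \<in> {0<..<1}" for x
      by (rule norm_J_exp_bound[OF i lip[OF f g M l(1) fg]]) (use l L M that in auto)
    then have "AE x in mD. cmod (J (\<lambda>x. \<Psi> f x - \<Psi> g x) x) \<le> L * M / l * exp (l * x)"
      by (intro AE_mD_I) auto
    then have "cmod (J (J (\<lambda>x. \<Psi> f x - \<Psi> g x)) x) \<le> L * M / l / l * exp (l * x)"
      by (rule norm_J_exp_bound[OF J_integrable[OF i]]) (use l L M x in auto)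
    moreover have "J (J (\<lambda>x. \<Psi> f x - \<Psi> g x)) x = S f x - S g x"
    proof -
      have "J (\<lambda>x. \<Psi> f x - \<Psi> g x) = (\<lambda>x. J (\<Psi> f) x - J (\<Psi> g) x)"
        by (intro ext J_diff int f g)
      then show ?thesis unfolding S_def by (simp add: J_diff J_integrable int f g)
    qed
    moreover have "L * M / l / l * exp (l * x) \<le> M / 2 * exp (l * x)"
      using mult_left_mono[OF Ll M] by (intro mult_right_mono) (auto simp: mult.commute)
    ultimately show ?thesis by (metis order_trans)
  qed
  define f where "f = rec_nat F (\<lambda>n g x. F x + S g x)"
  have f0: "f 0 = F" and fS: "f (Suc n) = (\<lambda>x. F x + S (f n) x)" for n by (auto simp: f_def)
  have f_bm: "bounded_measurable (f n)" for n
    by (induction n) (auto simp: f0 fS intro!: bounded_measurable_add S_bm F)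
  obtain K where K: "\<And>x. x \<in> {0<..<1} \<Longrightarrow> cmod (S F x) \<le> K"
    using S_bm[OF F] unfolding bounded_measurable_def by blast
  have K0: "K \<ge> 0" using order_trans[OF norm_ge_zero K[of "1/2"]] by simp
  have step: "cmod (f (Suc n) x - f n x) \<le> K * (1/2) ^ n * exp (l * x)" if "x \<in> {0<..<1}" for n x
    using that
  proof (induction n arbitrary: x)
    case 0
    have "K * 1 \<le> K * exp (l * x)" using 0 l K0 by (intro mult_left_mono) auto
    then show ?case using K[OF 0] by (simp add: f0 fS)
  next
    case (Suc n)
    have "cmod (S (f (Suc n)) x - S (f n) x) \<le> (K * (1/2) ^ n) / 2 * exp (l * x)"
      by (rule contr[OF f_bm f_bm]) (use Suc K0 in auto)
    then show ?case by (simp add: fS[of "Suc n"] fS[of n])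
  qed
  have tail: "cmod (f (n + k) x - f n x) \<le> 2 * K * (1/2) ^ n * exp (l * x)" if x: "x \<in> {0<..<1}" for n k x
  proof -
    \<comment> \<open>Keeping the exact geometric sum lets the induction on \<open>k\<close> close;
      afterwards the subtracted term is dropped, which leaves a bound uniform in \<open>k\<close>
      that survives the limit.\<close>
    have "cmod (f (n + k) x - f n x) \<le> (2 * K * (1/2) ^ n - 2 * K * (1/2) ^ (n + k)) * exp (l * x)"
    proof (induction k)
      case (Suc k)
      have "cmod (f (n + Suc k) x - f n x) \<le> cmod (f (Suc (n + k)) x - f (n + k) x) + cmod (f (n + k) x - f n x)"
        using norm_triangle_ineq[of "f (Suc (n + k)) x - f (n + k) x" "f (n + k) x - f n x"] by simp
      also have "\<dots> \<le> K * (1/2) ^ (n + k) * exp (l * x)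
          + (2 * K * (1/2) ^ n - 2 * K * (1/2) ^ (n + k)) * exp (l * x)"
        by (intro add_mono step Suc x)
      also have "\<dots> = (2 * K * (1/2) ^ n - 2 * K * (1/2) ^ (n + Suc k)) * exp (l * x)"
        by (simp add: algebra_simps)
      finally show ?case .
    qed simp
    also have "\<dots> \<le> 2 * K * (1/2) ^ n * exp (l * x)"
      using K0 by (intro mult_right_mono) auto
    finally show ?thesis .
  qed
  have small: "(\<lambda>n. C * (1/2) ^ n * exp (l * x)) \<longlonglongrightarrow> 0" for C x
    using tendsto_mult_right[OF tendsto_mult_left[OF LIMSEQ_power_zero[of "1/2 :: real"], of C], of "exp (l * x)"]
    by simp
  have "Cauchy (\<lambda>n. f n x)" if x: "x \<in> {0<..<1}" for x
  proof (rule metric_CauchyI)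
    fix e :: real assume "e > 0"
    then obtain N where N: "2 * (2 * K) * (1/2) ^ N * exp (l * x) < e"
      using order_tendstoD(2)[OF small[of "2 * (2 * K)" x]] by (auto simp: eventually_sequentially)
    have "dist (f m x) (f n x) < e" if "m \<ge> N" "n \<ge> N" for m n
    proof -
      have "dist (f m x) (f n x) \<le> dist (f m x) (f N x) + dist (f n x) (f N x)"
        by (rule dist_triangle2)
      also have "\<dots> \<le> 2 * K * (1/2) ^ N * exp (l * x) + 2 * K * (1/2) ^ N * exp (l * x)"
        using tail[OF x, of N "m - N"] tail[OF x, of N "n - N"] that by (intro add_mono) (auto simp: dist_norm)
      finally show ?thesis using N by (simp add: mult_ac)
    qed
    then show "\<exists>M. \<forall>m\<ge>M. \<forall>n\<ge>M. dist (f m x) (f n x) < e" by blast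
  qed
  then have lim: "(\<lambda>n. f n x) \<longlonglongrightarrow> lim (\<lambda>n. f n x)" if "x \<in> {0<..<1}" for x
    using that convergent_LIMSEQ_iff Cauchy_convergent_iff by blast
  \<comment> \<open>Outside (0,1) the value of \<open>lim\<close> is uncontrolled, but no later step
    looks there.\<close>
  define g where "g x = lim (\<lambda>n. f n x)" for x
  have g_tail: "cmod (g x - f n x) \<le> 2 * K * (1/2) ^ n * exp (l * x)" if x: "x \<in> {0<..<1}" for n x
  proof (rule tendsto_upperbound)
    show "(\<lambda>k. cmod (f (n + k) x - f n x)) \<longlonglongrightarrow> cmod (g x - f n x)"
      unfolding g_def using LIMSEQ_ignore_initial_segment[OF lim[OF x], of n]
      by (intro tendsto_intros) (simp add: add.commute)
  qed (use tail[OF x] in auto)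
  have g_bm: "bounded_measurable g"
    unfolding bounded_measurable_def
  proof
    show "g \<in> borel_measurable mD"
      by (rule borel_measurable_LIMSEQ_metric[OF bounded_measurable_measurable[OF f_bm]])
         (use lim in \<open>simp add: g_def\<close>)
    obtain M where M: "\<And>x. x \<in> {0<..<1} \<Longrightarrow> cmod (F x) \<le> M"
      using F unfolding bounded_measurable_def by blast
    have "cmod (g x) \<le> M + 2 * K * exp l" if x: "x \<in> {0<..<1}" for x
    proof -
      have "cmod (g x) \<le> cmod (F x) + cmod (g x - F x)"
        using norm_triangle_ineq[of "F x" "g x - F x"] by simp
      also have "\<dots> \<le> M + 2 * K * exp (l * x)"
        using g_tail[OF x, of 0] M[OF x] by (intro add_mono) (auto simp: f0)
      also have "\<dots> \<le> M + 2 * K * exp l"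
        using x l K0 by (intro add_left_mono mult_left_mono) auto
      finally show ?thesis .
    qed
    then show "\<exists>M. \<forall>x\<in>{0<..<1}. cmod (g x) \<le> M" by blast
  qed
  have "g x = F x + S g x" if x: "x \<in> {0<..<1}" for x
  proof (rule LIMSEQ_unique)
    show "(\<lambda>n. f (Suc n) x) \<longlonglongrightarrow> g x"
      unfolding g_def using lim[OF x] by (rule LIMSEQ_Suc)
    have "(\<lambda>n. S (f n) x - S g x) \<longlonglongrightarrow> 0"
    proof (rule Lim_null_comparison)
      have "cmod (S g x - S (f n) x) \<le> (2 * K * (1/2) ^ n) / 2 * exp (l * x)" for n
        by (rule contr[OF g_bm f_bm _ g_tail x]) (use K0 in auto)
      then show "\<forall>\<^sub>F n in sequentially. cmod (S (f n) x - S g x) \<le> K * (1/2) ^ n * exp (l * x)"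
        by (simp add: norm_minus_commute)
    qed (rule small)
    from tendsto_add[OF tendsto_const[of "F x + S g x"] this]
    show "(\<lambda>n. f (Suc n) x) \<longlonglongrightarrow> F x + S g x" by (simp add: fS)
  qed
  with g_bm show ?thesis unfolding S_def by blast
qed

text \<open>The integral form of the initial value problem f'' = F'' + c q f. It supplies the
  positive test function for small \<omega> and the one that detects \<open>u2\<close>.\<close>

lemma volterra_mult:
  assumes q: "q \<in> Linfty" and F: "bounded_measurable F"
  shows "\<exists>f. bounded_measurable f \<and>
    (\<forall>x\<in>{0<..<1}. f x = F x + J (J (\<lambda>x. c * (complex_of_real (q x) * f x))) x)"
proof -
  obtain Q where Q: "AE x in mD. \<bar>q x\<bar> \<le> Q" using q by (auto simp: Linfty_def)
  have "\<not> Q < 0"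
  proof
    assume "Q < 0"
    with Q have "AE x in mD. False" by (auto elim!: eventually_mono)
    then show False using not_AE_mD_False by simp
  qed
  then have Q0: "Q \<ge> 0" by simp
  show ?thesis
  proof (rule volterra_equation[OF _ _ _ F, where L = "cmod c * Q"])
    show "integrable mD (\<lambda>x. c * (complex_of_real (q x) * f x))" if "bounded_measurable f" for f
      by (intro L2_integrable L2_cmult L2_Linfty_mult q bounded_measurable_L2 that)
    fix f g M l
    assume fg: "\<And>x. x \<in> {0<..<1} \<Longrightarrow> cmod (f x - g x) \<le> M * exp (l * x)"
    show "AE x in mD. cmod (c * (complex_of_real (q x) * f x) - c * (complex_of_real (q x) * g x))
        \<le> cmod c * Q * M * exp (l * x)"
      using Q AE_space
    proof eventually_elim
      case (elim x)
      have "\<bar>q x\<bar> * cmod (f x - g x) \<le> Q * (M * exp (l * x))"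
        using elim Q0 fg[of x] by (intro mult_mono) auto
      from mult_left_mono[OF this, of "cmod c"] show ?case
        by (simp add: right_diff_distrib[symmetric] norm_mult mult.assoc)
    qed
  qed (use Q0 in auto)
qed

text \<open>Here \<Psi> is \<open>- J (J f)\<close>, a nonlocal operator; this is why the Lipschitz
  hypothesis of \<open>volterra_equation\<close> is phrased with exponential weights and not
  pointwise. For \<open>l \<ge> 1\<close> each \<open>J\<close> preserves the weighted bound, whence
  \<open>L = 1\<close>.\<close>

lemma volterra_fourth_order:
  assumes F: "bounded_measurable F"
  shows "\<exists>f. bounded_measurable f \<and> (\<forall>x\<in>{0<..<1}. f x = F x - J (J (J (J f))) x)"
proof -
  have "\<exists>f. bounded_measurable f \<and> (\<forall>x\<in>{0<..<1}. f x = F x + J (J (\<lambda>x. - 1 * J (J f) x)) x)"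
  proof (rule volterra_equation[OF _ _ _ F, where L = 1])
    show "integrable mD (\<lambda>x. - 1 * J (J f) x)" if "bounded_measurable f" for f
      by (intro integrable_mult_right J_integrable bounded_measurable_integrable that)
    fix f g M l
    assume f: "bounded_measurable f" and g: "bounded_measurable g" and M: "M \<ge> (0 :: real)" and l: "l \<ge> (1 :: real)"
      and fg: "\<And>x. x \<in> {0<..<1} \<Longrightarrow> cmod (f x - g x) \<le> M * exp (l * x)"
    note fi = bounded_measurable_integrable[OF f] and gi = bounded_measurable_integrable[OF g]
    have J_le: "AE x in mD. cmod (J h x) \<le> M * exp (l * x)"
      if h: "integrable mD h" and "AE x in mD. cmod (h x) \<le> M * exp (l * x)" for h
    proof (rule AE_mD_I)
      fix x :: real assume x: "0 < x" "x < 1"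
      have "cmod (J h x) \<le> M / l * exp (l * x)"
        by (rule norm_J_exp_bound) (use that l M x in auto)
      also have "\<dots> \<le> M * exp (l * x)"
        using l mult_left_mono[OF l M] by (intro mult_right_mono) (auto simp: divide_le_eq)
      finally show "cmod (J h x) \<le> M * exp (l * x)" .
    qed
    have "J (J f) x - J (J g) x = J (J (\<lambda>x. f x - g x)) x" for x
    proof -
      have "J (\<lambda>x. f x - g x) = (\<lambda>x. J f x - J g x)" by (intro ext J_diff fi gi)
      then show ?thesis by (simp add: J_diff J_integrable fi gi)
    qed
    moreover have "AE x in mD. cmod (J (J (\<lambda>x. f x - g x)) x) \<le> M * exp (l * x)"
      by (intro J_le J_integrable Bochner_Integration.integrable_diff fi gi) (rule AE_mD_I, use fg in auto)
    ultimately show "AE x in mD. cmod (- 1 * J (J f) x - - 1 * J (J g) x) \<le> 1 * M * exp (l * x)"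
      by (simp add: norm_minus_commute)
  qed simp
  moreover have "J (J (\<lambda>x. - 1 * h x)) x = - J (J h) x" for h x
  proof -
    have "J (\<lambda>x. - 1 * h x) = (\<lambda>x. - 1 * J h x)" by (intro ext J_cmult)
    then show ?thesis by (simp only: J_cmult) simp
  qed
  ultimately show ?thesis by simp
qed

subsection \<open>The Riesz representer\<close>

lemma L2_inner_integrable: "f \<in> L2 \<Longrightarrow> g \<in> L2 \<Longrightarrow> integrable mD (\<lambda>x. f x * cnj (g x))"
  by (rule L2_mult_integrable[OF _ L2_cnj])

lemma L2_inner_add_left:
  "f \<in> L2 \<Longrightarrow> g \<in> L2 \<Longrightarrow> h \<in> L2 \<Longrightarrow> L2_inner (\<lambda>x. f x + g x) h = L2_inner f h + L2_inner g h"
  unfolding L2_inner_def distrib_right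
  by (intro Bochner_Integration.integral_add L2_inner_integrable)

lemma L2_inner_diff_left:
  "f \<in> L2 \<Longrightarrow> g \<in> L2 \<Longrightarrow> h \<in> L2 \<Longrightarrow> L2_inner (\<lambda>x. f x - g x) h = L2_inner f h - L2_inner g h"
  unfolding L2_inner_def left_diff_distrib
  by (intro Bochner_Integration.integral_diff L2_inner_integrable)

lemma L2_inner_cong_AE:
  assumes "f \<in> L2" "f' \<in> L2" "g \<in> L2" "g' \<in> L2"
    and "AE x in mD. f x = f' x" "AE x in mD. g x = g' x"
  shows "L2_inner f g = L2_inner f' g'"
  unfolding L2_inner_def
proof (rule integral_cong_AE)
  show "AE x in mD. f x * cnj (g x) = f' x * cnj (g' x)"
    using assms(5,6) by eventually_elim simp
qed (intro borel_measurable_integrable L2_inner_integrable assms)+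

lemma J_cong: "(\<And>x. x \<in> {0<..<1} \<Longrightarrow> f x = g x) \<Longrightarrow> J f = J g"
  unfolding J_def by (intro ext Bochner_Integration.integral_cong) auto

lemma J_lincomb:
  assumes "integrable mD f" "integrable mD g"
  shows "J (\<lambda>x. a * f x + b * g x) = (\<lambda>x. a * J f x + b * J g x)"
  using assms by (intro ext) (simp add: J_add J_cmult)

text \<open>Explains the moment conditions used below: if \<open>h\<close> and \<open>J h\<close>
  both have mean 0, then \<open>h\<close> is orthogonal to all affine functions.\<close>

lemma integral_ident_mult:
  assumes "integrable mD h"
  shows "(LINT x|mD. of_real x * h x) = (LINT x|mD. h x) - (LINT x|mD. J h x)"
proof -
  have "(LINT x|mD. of_real x * h x) = (LINT x|mD. J (\<lambda>_. 1) x * h x)"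
    by (rule Bochner_Integration.integral_cong) (auto simp: J_1)
  also have "\<dots> = (LINT x|mD. h x) - (LINT x|mD. J h x)"
    using integral_J_mult[of "\<lambda>_. 1" h] assms measure_mD_space by simp
  finally show ?thesis .
qed

text \<open>Integration by parts for \<open>w = J (J h)\<close>, which satisfies \<open>w'' = h\<close> and, by the two moment
  conditions, \<open>w = w' = 0\<close> at both end points.\<close>

lemma L2_inner_J_J:
  assumes h: "h \<in> L2" and g: "g \<in> L2" and f: "f \<in> L2"
    and moments: "(LINT x|mD. h x) = 0" "(LINT x|mD. J h x) = 0"
    and rep: "AE x in mD. f x = a + b * of_real x + J (J g) x"
  shows "L2_inner (J (J h)) g = L2_inner h f"
proof -
  note hi = L2_integrable[OF h]
  let ?g = "\<lambda>x. cnj (g x)"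
  have gi: "integrable mD ?g" by (intro L2_integrable L2_cnj g)
  have JJ: "J (J ?g) x = cnj (J (J g) x)" for x
  proof -
    have "J ?g = (\<lambda>x. cnj (J g x))" by (intro ext J_cnj)
    then show ?thesis by (simp add: J_cnj)
  qed
  have "L2_inner (J (J h)) g = (LINT x|mD. h x * J (J ?g) x)"
    unfolding L2_inner_def
    using integral_J_mult[OF J_integrable[OF hi] gi] integral_J_mult[OF hi J_integrable[OF gi]]
    by (simp add: moments del: Bochner_Integration.integral_cnj)
  moreover have "L2_inner h f = (LINT x|mD. h x * J (J ?g) x)"
  proof -
    have "L2_inner h f = (LINT x|mD. cnj a * h x + cnj b * (of_real x * h x) + h x * J (J ?g) x)"
      unfolding L2_inner_def
    proof (rule integral_cong_AE)
      show "AE x in mD. h x * cnj (f x) = cnj a * h x + cnj b * (of_real x * h x) + h x * J (J ?g) x"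
        using rep by eventually_elim (simp add: JJ algebra_simps)
      show "(\<lambda>x. h x * cnj (f x)) \<in> borel_measurable mD"
        by (intro borel_measurable_integrable L2_inner_integrable h f)
      have [measurable]: "h \<in> borel_measurable mD" "?g \<in> borel_measurable mD"
        by (intro borel_measurable_integrable hi gi)+
      show "(\<lambda>x. cnj a * h x + cnj b * (of_real x * h x) + h x * J (J ?g) x) \<in> borel_measurable mD"
        by measurable
    qed
    also have "\<dots> = cnj a * (LINT x|mD. h x) + cnj b * (LINT x|mD. of_real x * h x) + (LINT x|mD. h x * J (J ?g) x)"
    proof -
      have "integrable mD (\<lambda>x. of_real x * h x)"
        by (rule L2_mult_integrable[OF _ h]) (rule L2_bounded[of _ 1], auto)
      moreover have "integrable mD (\<lambda>x. h x * J (J ?g) x)"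
        by (intro L2_mult_integrable h J_L2 J_integrable gi)
      ultimately show ?thesis using hi by simp
    qed
    finally show ?thesis using integral_ident_mult[OF hi] moments by simp
  qed
  ultimately show ?thesis by simp
qed

section \<open>The fourth-order problem with natural boundary conditions\<close>

lemma AE_affine_eq_0:
  assumes "AE x in mD. a + b * complex_of_real x = 0"
  shows "a = 0 \<and> b = 0"
proof (rule ccontr)
  assume *: "\<not> (a = 0 \<and> b = 0)"
  \<comment> \<open>The only candidate for a real zero when \<open>b\<close> is nonzero. For
    \<open>b = 0\<close> the division yields 0, which is harmless because the equation then gives
    \<open>a = 0\<close> at once.\<close>
  have "AE x in mD. x \<noteq> Re (- a / b)" by (rule AE_mD_neq)
  with assms have "AE x in mD. False"
  proof eventually_elim
    case (elim x)
    then have b: "b \<noteq> 0" using * by auto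
    have "b * complex_of_real x = - a" using elim(1) by (metis add_eq_0_iff2 add.commute)
    then have "complex_of_real x = - a / b" using b by (simp add: field_simps)
    then have "x = Re (- a / b)" by (metis Re_complex_of_real)
    then show ?case using elim by simp
  qed
  then show False using not_AE_mD_False by simp
qed

lemma L2_inner_minus_self_eq_0:
  assumes v: "v \<in> L2" and w: "w \<in> L2" and eq: "L2_inner w (\<lambda>x. - w x) = L2_inner v v"
  shows "AE x in mD. v x = 0" "AE x in mD. w x = 0"
proof -
  have "L2_inner w (\<lambda>x. - w x) = - L2_inner w w" by (simp add: L2_inner_def)
  then have "complex_of_real ((LINT x|mD. (cmod (v x))\<^sup>2) + (LINT x|mD. (cmod (w x))\<^sup>2)) = 0"
    using eq unfolding L2_inner_self by simp
  then have "(LINT x|mD. (cmod (v x))\<^sup>2) + (LINT x|mD. (cmod (w x))\<^sup>2) = 0"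
    by (simp only: of_real_eq_0_iff)
  moreover have "(LINT x|mD. (cmod (v x))\<^sup>2) \<ge> 0" "(LINT x|mD. (cmod (w x))\<^sup>2) \<ge> 0" by simp_all
  ultimately have "(LINT x|mD. (cmod (v x))\<^sup>2) = 0" "(LINT x|mD. (cmod (w x))\<^sup>2) = 0"
    by linarith+
  then show "AE x in mD. v x = 0" "AE x in mD. w x = 0"
    by (simp_all add: L2_norm_eq_0 v w)
qed

text \<open>Energy method: with w = \<open>J (J v)\<close> the equation says v'' = - w. Integration
  by parts, free of boundary terms by the moments, turns this into <w, -w> = <v, v>, so both norms
  vanish and the affine part is all that is left of the equation.\<close>

lemma fourth_order_natural_bvp_unique:
  assumes v: "bounded_measurable v"
    and eq: "\<And>x. x \<in> {0<..<1} \<Longrightarrow> v x = a + b * of_real x - J (J (J (J v))) x"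
    and moments: "(LINT x|mD. v x) = 0" "(LINT x|mD. J v x) = 0"
  shows "a = 0 \<and> b = 0"
proof (rule AE_affine_eq_0)
  define w where "w = J (J v)"
  note vi = bounded_measurable_integrable[OF v]
  have wL2: "w \<in> L2" unfolding w_def by (intro J_L2 J_integrable vi)
  have JJw: "J (J (\<lambda>x. - w x)) x = - J (J w) x" for x
  proof -
    have "J (\<lambda>x. - w x) = (\<lambda>x. - J w x)" using J_cmult[of "-1" w] by (intro ext) simp
    then show ?thesis using J_cmult[of "-1" "J w"] by simp
  qed
  have "L2_inner (J (J v)) (\<lambda>x. - w x) = L2_inner v v"
  proof (rule L2_inner_J_J[OF _ _ _ moments])
    show "AE x in mD. v x = a + b * of_real x + J (J (\<lambda>x. - w x)) x"
      using eq by (intro AE_mD_I) (simp add: JJw[unfolded w_def] w_def)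
    show "(\<lambda>x. - w x) \<in> L2" using L2_cmult[OF wL2, of "-1"] by simp
  qed (intro bounded_measurable_L2 v)+
  then have v0: "AE x in mD. v x = 0"
    using L2_inner_minus_self_eq_0(1)[OF bounded_measurable_L2[OF v] wL2] by (simp add: w_def)
  have "J v = J (\<lambda>x. 0)" by (rule ext, rule J_cong_AE) (use vi v0 in auto)
  then have J4: "J (J (J (J v))) x = 0" for x by simp
  have "AE x in mD. x \<in> {0<..<1}" by (intro AE_mD_I) auto
  then show "AE x in mD. a + b * complex_of_real x = 0"
    using v0
  proof eventually_elim
    case (elim x)
    then show ?case using eq[of x] J4 by simp
  qed
qed

text \<open>Viewed as a real-linear endomorphism of a finite-dimensional space, the system is
  surjective once it is injective.\<close>

lemma complex_linear_system_solvable: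
  fixes m11 m12 m21 m22 :: complex
  assumes "\<And>a b. a * m11 + b * m12 = 0 \<Longrightarrow> a * m21 + b * m22 = 0 \<Longrightarrow> a = 0 \<and> b = 0"
  shows "\<exists>a b. a * m11 + b * m12 = r \<and> a * m21 + b * m22 = s"
proof -
  let ?L = "\<lambda>(a, b). (a * m11 + b * m12, a * m21 + b * m22)"
  have lin: "linear ?L"
    by (rule linearI) (auto simp: algebra_simps)
  have "inj ?L"
    unfolding linear_injective_0[OF lin]
  proof (intro allI impI)
    fix p assume "?L p = 0"
    then show "p = 0" using assms[of "fst p" "snd p"] by (simp add: split_beta zero_prod_def prod_eq_iff)
  qed
  with lin have "surj ?L" by (rule linear_injective_imp_surjective) simp
  from surjD[OF this, of "(r, s)"] obtain p where "(r, s) = ?L p" ..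
  then show ?thesis by (intro exI[of _ "fst p"] exI[of _ "snd p"]) (simp add: split_beta)
qed

text \<open>A shooting argument. \<open>R\<close> and \<open>S\<close> solve the homogeneous
  equation with affine parts 1 and x, \<open>P\<close> absorbs \<open>F\<close>, and
  \<open>a\<close>, \<open>b\<close> are fitted to the two moments. Uniqueness makes the 2 x 2
  system for them nonsingular.\<close>

lemma fourth_order_natural_bvp:
  assumes F: "bounded_measurable F"
  shows "\<exists>a b v. bounded_measurable v
    \<and> (\<forall>x\<in>{0<..<1}. v x = a + b * of_real x + F x - J (J (J (J v))) x)
    \<and> (LINT x|mD. v x) = r \<and> (LINT x|mD. J v x) = s"
proof -
  have bm: "bounded_measurable (\<lambda>x. 1)" "bounded_measurable (\<lambda>x. complex_of_real x)"
    by (auto simp: bounded_measurable_def intro!: exI[of _ 1])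
  obtain R where R: "bounded_measurable R" "\<And>x. x \<in> {0<..<1} \<Longrightarrow> R x = 1 - J (J (J (J R))) x"
    using volterra_fourth_order[OF bm(1)] by blast
  obtain S where S: "bounded_measurable S" "\<And>x. x \<in> {0<..<1} \<Longrightarrow> S x = of_real x - J (J (J (J S))) x"
    using volterra_fourth_order[OF bm(2)] by blast
  obtain P where P: "bounded_measurable P" "\<And>x. x \<in> {0<..<1} \<Longrightarrow> P x = F x - J (J (J (J P))) x"
    using volterra_fourth_order[OF F] by blast
  note i = bounded_measurable_integrable[OF R(1)] bounded_measurable_integrable[OF S(1)]
    bounded_measurable_integrable[OF P(1)]
  define V where "V a b = (\<lambda>x. a * R x + b * S x)" for a b
  have scale: "bounded_measurable (\<lambda>x. c * f x)" if f: "bounded_measurable f" for c f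
  proof -
    obtain M where "\<forall>x\<in>{0<..<1}. cmod (f x) \<le> M" using f by (auto simp: bounded_measurable_def)
    then have "\<forall>x\<in>{0<..<1}. cmod (c * f x) \<le> cmod c * M"
      by (auto simp: norm_mult intro!: mult_left_mono)
    with f show ?thesis by (auto simp: bounded_measurable_def)
  qed
  have V: "bounded_measurable (V a b)" for a b
    unfolding V_def by (intro bounded_measurable_add scale R S)
  note Vi = bounded_measurable_integrable[OF V]
  have JV: "J (V a b) = (\<lambda>x. a * J R x + b * J S x)" for a b
    unfolding V_def by (rule J_lincomb[OF i(1,2)])
  have JJV: "J (J (J (J (V a b)))) = (\<lambda>x. a * J (J (J (J R))) x + b * J (J (J (J S))) x)" for a b
    by (simp add: JV J_lincomb J_integrable i)
  have Veq: "V a b x = a + b * of_real x - J (J (J (J (V a b)))) x" if "x \<in> {0<..<1}" for a b x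
    unfolding JJV unfolding V_def by (simp add: R(2)[OF that] S(2)[OF that] algebra_simps)
  have int1: "(LINT x|mD. V a b x) = a * (LINT x|mD. R x) + b * (LINT x|mD. S x)" for a b
    unfolding V_def using i by simp
  have int2: "(LINT x|mD. J (V a b) x) = a * (LINT x|mD. J R x) + b * (LINT x|mD. J S x)" for a b
    unfolding JV using i by (simp add: J_integrable)
  have "\<exists>a b. a * (LINT x|mD. R x) + b * (LINT x|mD. S x) = r - (LINT x|mD. P x)
      \<and> a * (LINT x|mD. J R x) + b * (LINT x|mD. J S x) = s - (LINT x|mD. J P x)"
  proof (rule complex_linear_system_solvable)
    fix a b
    assume "a * (LINT x|mD. R x) + b * (LINT x|mD. S x) = 0" "a * (LINT x|mD. J R x) + b * (LINT x|mD. J S x) = 0"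
    then show "a = 0 \<and> b = 0"
      by (intro fourth_order_natural_bvp_unique[OF V Veq]) (simp_all add: int1 int2)
  qed
  then obtain a b where ab: "(LINT x|mD. V a b x) = r - (LINT x|mD. P x)"
      "(LINT x|mD. J (V a b) x) = s - (LINT x|mD. J P x)"
    unfolding int1 int2 by blast
  let ?v = "\<lambda>x. V a b x + P x"
  have Jv: "J ?v = (\<lambda>x. J (V a b) x + J P x)" using J_lincomb[where a = 1 and b = 1, OF Vi i(3)] by simp
  have JJv: "J (J (J (J ?v))) = (\<lambda>x. J (J (J (J (V a b)))) x + J (J (J (J P))) x)"
    using J_lincomb[where a = 1 and b = 1, simplified] by (simp add: Jv J_integrable Vi i)
  show ?thesis
  proof (intro exI conjI ballI)
    show "bounded_measurable ?v" by (intro bounded_measurable_add V P)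
    show "?v x = a + b * of_real x + F x - J (J (J (J ?v))) x" if "x \<in> {0<..<1}" for x
      unfolding JJv using Veq[OF that, of a b] P(2)[OF that] by simp
    show "(LINT x|mD. ?v x) = r" using ab Vi i by simp
    show "(LINT x|mD. J ?v x) = s" unfolding Jv using ab Vi i by (simp add: J_integrable)
  qed
qed

text \<open>The first component of the representer solves
  \<open>v + (v'' - p)'' = B\<close> with \<open>v'' - p\<close> and its derivative vanishing at both end points.\<close>

lemma X_riesz_representer:
  assumes A: "A \<in> L2" and p: "p \<in> L2" and B: "B \<in> L2"
  shows "\<exists>v\<in>X_space. \<forall>\<phi>\<in>X_space.
    X_inner v \<phi> = L2_inner A (snd \<phi>) + L2_inner p (wderiv2 (fst \<phi>)) + L2_inner B (fst \<phi>)"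
proof -
  note ii = L2_integrable[OF p] L2_integrable[OF B]
  \<comment> \<open>Integrating the equation twice gives v'' = p + \<open>J (J (B - v))\<close>; two
    further integrations produce this forcing term, the term - J^4 v and the free affine
    part.\<close>
  have "bounded_measurable (\<lambda>x. J (J p) x + J (J (J (J B))) x)"
    by (intro bounded_measurable_add bounded_measurable_J J_integrable ii)
  from fourth_order_natural_bvp[OF this] obtain a b v where v: "bounded_measurable v"
    "\<And>x. x \<in> {0<..<1} \<Longrightarrow> v x = a + b * of_real x + (J (J p) x + J (J (J (J B))) x) - J (J (J (J v))) x"
    "(LINT x|mD. v x) = (LINT x|mD. B x)" "(LINT x|mD. J v x) = (LINT x|mD. J B x)" by blast
  note vi = bounded_measurable_integrable[OF v(1)] and vL2 = bounded_measurable_L2[OF v(1)]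
  \<comment> \<open>\<open>J (J h)\<close> is v'' - p. It and its derivative vanish at 0 by
    construction of \<open>J\<close>, and at 1 because both moments of \<open>h\<close> are
    0.\<close>
  define h where "h = (\<lambda>x. B x - v x)"
  have h: "h \<in> L2" unfolding h_def by (intro L2_diff B vL2)
  have Jh: "J h = (\<lambda>x. J B x - J v x)"
    unfolding h_def by (intro ext J_diff ii vi)
  have JJh: "J (J h) = (\<lambda>x. J (J B) x - J (J v) x)"
    unfolding Jh by (intro ext J_diff J_integrable ii vi)
  have J4h: "J (J (J h)) = (\<lambda>x. J (J (J B)) x - J (J (J v)) x)"
    unfolding JJh by (intro ext J_diff J_integrable ii vi)
  have moments: "(LINT x|mD. h x) = 0" "(LINT x|mD. J h x) = 0"
    unfolding Jh unfolding h_def using v(3,4) ii vi by (simp_all add: J_integrable)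
  define g where "g = (\<lambda>x. p x + J (J h) x)"
  have JJhL2: "J (J h) \<in> L2" by (intro J_L2 J_integrable L2_integrable h)
  have g: "g \<in> L2" unfolding g_def by (intro L2_add p JJhL2)
  have Jg: "J g = (\<lambda>x. J p x + J (J (J h)) x)"
    unfolding g_def by (intro ext J_add ii J_integrable L2_integrable h)
  have JJg: "J (J g) x = J (J p) x + (J (J (J (J B))) x - J (J (J (J v))) x)" for x
    unfolding Jg J4h by (simp add: J_add J_diff J_integrable ii vi)
  have rep: "AE x in mD. v x = a + b * of_real x + J (J g) x"
    using v(2) by (intro AE_mD_I) (simp add: JJg)
  note vH2 = H2_I[OF g bounded_measurable_measurable[OF v(1)] rep]
  show ?thesis
  proof (intro bexI ballI)
    \<comment> \<open>The second factor of \<open>X\<close> carries the plain \<open>L2\<close>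
      product, so there the datum \<open>A\<close> represents itself.\<close>
    show "(v, A) \<in> X_space" using vH2(1) A by (simp add: X_space_def)
    fix \<phi> assume "\<phi> \<in> X_space"
    then have \<phi>: "fst \<phi> \<in> H2" "snd \<phi> \<in> L2" by (auto simp: X_space_def)
    note w = H2_wderiv2(1)[OF \<phi>(1)] and \<phi>L2 = H2_L2[OF \<phi>(1)]
    obtain a' b' where "AE x in mD. fst \<phi> x = a' + b' * of_real x + J (J (wderiv2 (fst \<phi>))) x"
      using H2_representation[OF \<phi>(1)] by blast
    then have parts: "L2_inner (J (J h)) (wderiv2 (fst \<phi>)) = L2_inner h (fst \<phi>)"
      by (rule L2_inner_J_J[OF h w \<phi>L2 moments])
    have "L2_inner (wderiv2 v) (wderiv2 (fst \<phi>)) = L2_inner g (wderiv2 (fst \<phi>))"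
      using H2_wderiv2(1)[OF vH2(1)] g w vH2(2) by (intro L2_inner_cong_AE) auto
    also have "\<dots> = L2_inner p (wderiv2 (fst \<phi>)) + L2_inner h (fst \<phi>)"
      unfolding g_def parts[symmetric] by (intro L2_inner_add_left p JJhL2 w)
    also have "L2_inner h (fst \<phi>) = L2_inner B (fst \<phi>) - L2_inner v (fst \<phi>)"
      unfolding h_def by (intro L2_inner_diff_left B vL2 \<phi>L2)
    finally show "X_inner (v, A) \<phi> = L2_inner A (snd \<phi>) + L2_inner p (wderiv2 (fst \<phi>)) + L2_inner B (fst \<phi>)"
      by (simp add: X_inner_def H2_inner_def)
  qed
qed

subsection \<open>Non-vanishing of the operator\<close>

lemma H2_square_L2:
  assumes "u \<in> H2"
  shows "(\<lambda>x. (u x)\<^sup>2) \<in> L2"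
proof -
  obtain M where "AE x in mD. cmod (u x) \<le> M" using H2_AE_bounded[OF assms] by blast
  then show ?thesis
    unfolding power2_eq_square using H2_L2[OF assms] by (intro L2_bounded_mult) auto
qed

text \<open>Sorting the form by the data of the test pair brings it into the shape that
  \<open>X_riesz_representer\<close> handles, with \<open>u2\<close> in the role of
  \<open>p\<close>.\<close>

lemma T_form_eq:
  fixes \<omega> :: complex
  assumes q: "q \<in> Linfty" and \<chi>1: "\<chi>1 \<in> Linfty" and \<chi>2: "\<chi>2 \<in> Linfty"
    and u1: "u1 \<in> H2" and u2: "u2 \<in> L2" and \<phi>: "\<phi> \<in> X_space"
  defines "A \<equiv> \<lambda>x. wderiv2 u1 x + \<omega>\<^sup>2 * (complex_of_real (q x) * u1 x)
      + \<omega>\<^sup>2 * (complex_of_real (\<chi>1 x) * (cnj (u1 x) * u2 x))"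
    and "B \<equiv> \<lambda>x. 4 * \<omega>\<^sup>2 * (complex_of_real (q x) * u2 x) + \<omega>\<^sup>2 * (complex_of_real (\<chi>2 x) * (u1 x)\<^sup>2)"
  shows "A \<in> L2" "B \<in> L2"
    "T_form q \<chi>1 \<chi>2 \<omega> (u1, u2) \<phi>
      = L2_inner A (snd \<phi>) + L2_inner u2 (wderiv2 (fst \<phi>)) + L2_inner B (fst \<phi>)"
proof -
  obtain M where M: "AE x in mD. cmod (u1 x) \<le> M" using H2_AE_bounded[OF u1] by blast
  have cu: "(\<lambda>x. cnj (u1 x) * u2 x) \<in> L2"
    by (rule L2_bounded_mult[OF _ _ u2]) (use M L2_cnj[OF H2_L2[OF u1]] in \<open>auto simp: L2_def\<close>)
  show A: "A \<in> L2"
    unfolding A_def by (intro L2_add L2_cmult L2_Linfty_mult q \<chi>1 H2_wderiv2 u1 H2_L2[OF u1] cu)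
  show B: "B \<in> L2"
    unfolding B_def by (intro L2_add L2_cmult L2_Linfty_mult q \<chi>2 u1 u2 H2_square_L2)
  have \<phi>': "fst \<phi> \<in> H2" "snd \<phi> \<in> L2" using \<phi> by (auto simp: X_space_def)
  have "(LINT x|mD. u2 x * cnj (wderiv2 (fst \<phi>) x) + B x * cnj (fst \<phi> x))
      = L2_inner u2 (wderiv2 (fst \<phi>)) + L2_inner B (fst \<phi>)"
    unfolding L2_inner_def
    by (intro Bochner_Integration.integral_add L2_inner_integrable B u2 H2_wderiv2 H2_L2 \<phi>')
  then show "T_form q \<chi>1 \<chi>2 \<omega> (u1, u2) \<phi>
      = L2_inner A (snd \<phi>) + L2_inner u2 (wderiv2 (fst \<phi>)) + L2_inner B (fst \<phi>)"
    unfolding T_form_def A_def B_def L2_inner_def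
    by (simp add: split_beta algebra_simps)
qed

text \<open>Existence of a representer turns the choice in \<open>T\<close> into the Riesz identity;
  without it, the vanishing of \<open>T\<close> would carry no information.\<close>

lemma T_spec:
  assumes "q \<in> Linfty" "\<chi>1 \<in> Linfty" "\<chi>2 \<in> Linfty" "u \<in> X_space"
  shows "T q \<chi>1 \<chi>2 \<omega> u \<in> X_space"
    and "\<phi> \<in> X_space \<Longrightarrow> X_inner (T q \<chi>1 \<chi>2 \<omega> u) \<phi> = T_form q \<chi>1 \<chi>2 \<omega> u \<phi>"
proof -
  obtain u1 u2 where u: "u = (u1, u2)" "u1 \<in> H2" "u2 \<in> L2"
    using assms(4) by (auto simp: X_space_def)
  note form = T_form_eq[OF assms(1-3) u(2,3), where \<omega> = \<omega>]
  have zero: "(\<lambda>_. 0, \<lambda>_. 0) \<in> X_space"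
    using H2_I(1)[of "\<lambda>_. 0" "\<lambda>_. 0" 0 0] L2_const[of 0] by (simp add: X_space_def)
  have "\<exists>v. v \<in> X_space \<and> (\<forall>\<phi>\<in>X_space. X_inner v \<phi> = T_form q \<chi>1 \<chi>2 \<omega> u \<phi>)"
    using X_riesz_representer[OF form(1)[OF zero] u(3) form(2)[OF zero]] form(3) u(1) by auto
  from someI_ex[OF this]
  show "T q \<chi>1 \<chi>2 \<omega> u \<in> X_space"
    and "\<phi> \<in> X_space \<Longrightarrow> X_inner (T q \<chi>1 \<chi>2 \<omega> u) \<phi> = T_form q \<chi>1 \<chi>2 \<omega> u \<phi>"
    by (auto simp: T_def)
qed

text \<open>\<open>wderiv2\<close> is chosen for each representative separately, so its
  compatibility with null sets needs an argument: here \<open>u\<close> is represented with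
  \<open>a = b = 0\<close> and \<open>g = 0\<close>.\<close>

lemma wderiv2_AE_zero:
  assumes "u \<in> H2" "AE x in mD. u x = 0"
  shows "AE x in mD. wderiv2 u x = 0"
  using assms by (intro H2_I(2)[of "\<lambda>_. 0" u 0 0]) (auto simp: L2_const dest: H2_L2 L2_measurable)

lemma X_inner_zero_left:
  assumes v: "v \<in> X_space" and \<phi>: "\<phi> \<in> X_space" and 0: "X_eq v X_zero"
  shows "X_inner v \<phi> = 0"
proof -
  have zero: "L2_inner f g = 0" if "AE x in mD. f x = 0" for f g
    unfolding L2_inner_def using that by (intro integral_eq_zero_AE) (auto elim: eventually_mono)
  have "AE x in mD. fst v x = 0" "AE x in mD. snd v x = 0"
    using 0 by (auto simp: X_eq_def X_zero_def)
  moreover have "AE x in mD. wderiv2 (fst v) x = 0"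
    using v calculation by (intro wderiv2_AE_zero) (auto simp: X_space_def)
  ultimately show ?thesis by (simp add: X_inner_def H2_inner_def zero)
qed

text \<open>The positive solution \<open>\<phi>\<close> is a hypothesis, so that one argument serves
  both the small-frequency range and \<open>q = 1\<close>.\<close>

lemma T_injective_at_zero:
  fixes \<omega> :: real
  assumes q: "q \<in> Linfty" and \<chi>1: "\<chi>1 \<in> Linfty" and \<chi>2: "\<chi>2 \<in> Linfty"
    and pos: "AE x in mD. \<chi>2 x > 0" and \<omega>: "\<omega> > 0" and u: "u \<in> X_space"
    and real: "AE x in mD. fst u x \<in> \<real>"
    and T0: "X_eq (T q \<chi>1 \<chi>2 (complex_of_real \<omega>) u) X_zero"
    and \<phi>: "\<phi> \<in> H2" "AE x in mD. wderiv2 \<phi> x = - 4 * (of_real \<omega>)\<^sup>2 * (complex_of_real (q x) * \<phi> x)"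
      "AE x in mD. Re (\<phi> x) > 0"
  shows "X_eq u X_zero"
proof -
  define u1 u2 where "u1 = fst u" and "u2 = snd u"
  have u12: "u = (u1, u2)" "u1 \<in> H2" "u2 \<in> L2"
    using u by (auto simp: X_space_def u1_def u2_def)
  define w where "w = (complex_of_real \<omega>)\<^sup>2"
  define B where "B = (\<lambda>x. 4 * w * (complex_of_real (q x) * u2 x) + w * (complex_of_real (\<chi>2 x) * (u1 x)\<^sup>2))"
  note form = T_form_eq[OF q \<chi>1 \<chi>2 u12(2,3), where \<omega> = "complex_of_real \<omega>", folded w_def, folded B_def]
  have B: "B \<in> L2" by (rule form(2)[OF u])
  have test: "(LINT x|mD. u2 x * cnj (wderiv2 \<psi> x) + B x * cnj (\<psi> x)) = 0" if \<psi>: "\<psi> \<in> H2" for \<psi>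
  proof -
    have X: "(\<psi>, \<lambda>_. 0) \<in> X_space" using \<psi> L2_const by (simp add: X_space_def)
    have "T_form q \<chi>1 \<chi>2 (complex_of_real \<omega>) (u1, u2) (\<psi>, \<lambda>_. 0) = 0"
      using T_spec[OF q \<chi>1 \<chi>2 u, where \<omega> = "complex_of_real \<omega>"] X X_inner_zero_left[OF _ X T0] u12(1) by simp
    then have "L2_inner u2 (wderiv2 \<psi>) + L2_inner B \<psi> = 0"
      using form(3)[OF X] by (simp add: L2_inner_def)
    moreover have "(LINT x|mD. u2 x * cnj (wderiv2 \<psi> x) + B x * cnj (\<psi> x))
        = L2_inner u2 (wderiv2 \<psi>) + L2_inner B \<psi>"
      unfolding L2_inner_def
      by (intro Bochner_Integration.integral_add L2_inner_integrable B u12 H2_wderiv2 H2_L2 \<psi>)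
    ultimately show ?thesis by simp
  qed
  have int: "integrable mD (\<lambda>x. u2 x * cnj (wderiv2 \<psi> x) + B x * cnj (\<psi> x))" if "\<psi> \<in> H2" for \<psi>
    by (intro Bochner_Integration.integrable_add L2_inner_integrable B u12 H2_wderiv2 H2_L2 that)
  have "AE x in mD. u1 x = 0"
  proof -
    let ?I = "\<lambda>x. u2 x * cnj (wderiv2 \<phi> x) + B x * cnj (\<phi> x)"
    \<comment> \<open>\<open>\<phi>\<close> is only known to have positive real part. The two terms
      with \<open>u2\<close> cancel because \<open>w\<close> and \<open>q\<close> are real; the
      factor left in front of \<open>cnj (\<phi> x)\<close> is real too, so real parts
      suffice.\<close>
    have Re: "AE x in mD. Re (?I x) = \<omega>\<^sup>2 * (\<chi>2 x * ((Re (u1 x))\<^sup>2 * Re (\<phi> x)))"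
      using \<phi>(2) real
    proof eventually_elim
      case (elim x)
      then have r: "u1 x = of_real (Re (u1 x))" by (simp add: u1_def of_real_Re)
      have "?I x = w * (complex_of_real (\<chi>2 x) * (u1 x)\<^sup>2) * cnj (\<phi> x)"
        by (simp add: elim(1) B_def w_def algebra_simps)
      also have "\<dots> = of_real (\<omega>\<^sup>2 * (\<chi>2 x * (Re (u1 x))\<^sup>2)) * cnj (\<phi> x)"
        by (subst r) (simp add: w_def)
      finally show ?case by (simp add: mult.assoc)
    qed
    have "(LINT x|mD. Re (?I x)) = 0"
      using integral_Re[OF int[OF \<phi>(1)]] test[OF \<phi>(1)] by simp
    moreover have "AE x in mD. Re (?I x) \<ge> 0"
      using Re pos \<phi>(3) by eventually_elim simp
    ultimately have "AE x in mD. Re (?I x) = 0"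
      using integral_nonneg_eq_0_iff_AE[OF integrable_Re[OF int[OF \<phi>(1)]]] by simp
    then show ?thesis
      using Re pos \<phi>(3) real
    proof eventually_elim
      case (elim x)
      then have "Re (u1 x) = 0" using \<omega> by simp
      then show ?case using elim(5) by (simp add: u1_def complex_is_Real_iff complex_eq_iff)
    qed
  qed
  moreover have "AE x in mD. u2 x = 0"
  proof -
    have "bounded_measurable (J (J u2))"
      by (intro bounded_measurable_J J_integrable L2_integrable u12)
    \<comment> \<open>\<open>\<psi>\<close> solves the equation with right-hand side
      \<open>u2\<close> and zero initial data. With \<open>u1 = 0\<close> the \<chi>2 term of
      \<open>B\<close> is gone, and the tested identity collapses to the squared norm of
      \<open>u2\<close>.\<close>
    from volterra_mult[OF q this, of "- 4 * w"] obtain \<psi> where \<psi>: "bounded_measurable \<psi>"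
      "\<And>x. x \<in> {0<..<1} \<Longrightarrow> \<psi> x = J (J u2) x + J (J (\<lambda>x. - 4 * w * (complex_of_real (q x) * \<psi> x))) x"
      by blast
    define g where "g = (\<lambda>x. u2 x + - 4 * w * (complex_of_real (q x) * \<psi> x))"
    have q\<psi>: "(\<lambda>x. - 4 * w * (complex_of_real (q x) * \<psi> x)) \<in> L2"
      by (intro L2_cmult L2_Linfty_mult q bounded_measurable_L2 \<psi>(1))
    have g: "g \<in> L2" unfolding g_def by (intro L2_add u12 q\<psi>)
    have Jg: "J g = (\<lambda>x. J u2 x + J (\<lambda>x. - 4 * w * (complex_of_real (q x) * \<psi> x)) x)"
      unfolding g_def by (intro ext J_add L2_integrable u12 q\<psi>)
    have JJg: "J (J g) x = J (J u2) x + J (J (\<lambda>x. - 4 * w * (complex_of_real (q x) * \<psi> x))) x" for x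
      unfolding Jg by (intro J_add J_integrable L2_integrable u12 q\<psi>)
    have rep: "AE x in mD. \<psi> x = 0 + 0 * of_real x + J (J g) x"
      using \<psi>(2) by (intro AE_mD_I) (simp add: JJg)
    note \<psi>H2 = H2_I[OF g bounded_measurable_measurable[OF \<psi>(1)] rep]
    have "AE x in mD. u2 x * cnj (wderiv2 \<psi> x) + B x * cnj (\<psi> x) = complex_of_real ((cmod (u2 x))\<^sup>2)"
      using \<psi>H2(2) \<open>AE x in mD. u1 x = 0\<close>
    proof eventually_elim
      case (elim x)
      have "u2 x * cnj (wderiv2 \<psi> x) + B x * cnj (\<psi> x) = u2 x * cnj (u2 x)"
        by (simp add: elim B_def g_def w_def algebra_simps)
      then show ?case by (simp only: complex_norm_square)
    qed
    then have "(LINT x|mD. u2 x * cnj (wderiv2 \<psi> x) + B x * cnj (\<psi> x))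
        = (LINT x|mD. complex_of_real ((cmod (u2 x))\<^sup>2))"
      using int[OF \<psi>H2(1)] u12(3) by (intro integral_cong_AE) (auto simp: L2_def)
    then have "complex_of_real (LINT x|mD. (cmod (u2 x))\<^sup>2) = 0"
      using test[OF \<psi>H2(1)] by (simp only: integral_complex_of_real)
    then show ?thesis
      by (intro L2_norm_eq_0 u12) (simp only: of_real_eq_0_iff)
  qed
  ultimately show ?thesis by (simp add: X_eq_def X_zero_def u1_def u2_def)
qed

section \<open>Positive solutions of the homogeneous equation\<close>

lemma positive_solution_small_frequency:
  fixes \<omega> :: real
  assumes q: "q \<in> Linfty" and Q: "AE x in mD. \<bar>q x\<bar> \<le> Q" and small: "16 * \<omega>\<^sup>2 * Q \<le> 1"
  shows "\<exists>\<phi>\<in>H2. (AE x in mD. wderiv2 \<phi> x = - 4 * (of_real \<omega>)\<^sup>2 * (complex_of_real (q x) * \<phi> x))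
    \<and> (AE x in mD. Re (\<phi> x) > 0)"
proof -
  let ?c = "- 4 * (complex_of_real \<omega>)\<^sup>2"
  have "bounded_measurable (\<lambda>_. 1)" by (auto simp: bounded_measurable_def)
  from volterra_mult[OF q this, of ?c] obtain \<phi> where \<phi>: "bounded_measurable \<phi>"
    "\<And>x. x \<in> {0<..<1} \<Longrightarrow> \<phi> x = 1 + J (J (\<lambda>x. ?c * (complex_of_real (q x) * \<phi> x))) x"
    by blast
  let ?g = "\<lambda>x. ?c * (complex_of_real (q x) * \<phi> x)"
  have g: "?g \<in> L2" by (intro L2_cmult L2_Linfty_mult q bounded_measurable_L2 \<phi>(1))
  have rep: "AE x in mD. \<phi> x = 1 + 0 * of_real x + J (J ?g) x"
    using \<phi>(2) by (intro AE_mD_I) simp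
  note \<phi>H2 = H2_I[OF g bounded_measurable_measurable[OF \<phi>(1)] rep]
  \<comment> \<open>A self-consistent bound: since 4 \<omega>^2 Q is at most 1/4, the correction to
    the constant 1 is at most M/4. Hence M \<le> 1 + M/4, that is M \<le> 4/3, and the correction is
    at most 1/3.\<close>
  define M where "M = (SUP x\<in>{0<..<1}. cmod (\<phi> x))"
  have bdd: "bdd_above ((\<lambda>x. cmod (\<phi> x)) ` {0<..<1})"
    using \<phi>(1) unfolding bounded_measurable_def bdd_above_def by blast
  have le_M: "cmod (\<phi> x) \<le> M" if "x \<in> {0<..<1}" for x
    unfolding M_def by (rule cSUP_upper[OF that bdd])
  have M0: "M \<ge> 0" using order_trans[OF norm_ge_zero le_M[of "1/2"]] by simp
  have const_bound: "(LINT x|mD. cmod (h x)) \<le> C" if "integrable mD h" "AE x in mD. cmod (h x) \<le> C" for h :: "real \<Rightarrow> complex" and C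
  proof -
    have "(LINT x|mD. cmod (h x)) \<le> (LINT x|mD. C)"
      using that by (intro integral_mono_AE) auto
    then show ?thesis using measure_mD_space by simp
  qed
  have "AE x in mD. cmod (?g x) \<le> M / 4"
    using Q AE_space
  proof eventually_elim
    case (elim x)
    have "4 * \<omega>\<^sup>2 * \<bar>q x\<bar> \<le> 4 * \<omega>\<^sup>2 * Q" using elim by (intro mult_left_mono) auto
    also have "\<dots> \<le> 1 / 4" using small by simp
    finally have "4 * \<omega>\<^sup>2 * \<bar>q x\<bar> * cmod (\<phi> x) \<le> 1 / 4 * M"
      using le_M[of x] elim M0 by (intro mult_mono) auto
    then show ?case by (simp add: norm_mult norm_power mult.assoc)
  qed
  then have "cmod (J ?g x) \<le> M / 4" for x
    using norm_J_bound[OF L2_integrable[OF g], of x] const_bound[OF L2_integrable[OF g]] by fastforce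
  then have JJg: "cmod (J (J ?g) x) \<le> M / 4" for x
    using norm_J_bound[OF J_integrable[OF L2_integrable[OF g]], of x]
      const_bound[OF J_integrable[OF L2_integrable[OF g]], of "M / 4"] by fastforce
  have "cmod (\<phi> x) \<le> 1 + M / 4" if "x \<in> {0<..<1}" for x
    unfolding \<phi>(2)[OF that] using norm_triangle_ineq[of 1 "J (J ?g) x"] JJg[of x] by simp
  then have "M \<le> 1 + M / 4"
    unfolding M_def by (intro cSUP_least) auto
  then have M1: "M / 4 < 1" by simp
  have "Re (\<phi> x) > 0" if "x \<in> {0<..<1}" for x
    unfolding \<phi>(2)[OF that] using abs_Re_le_cmod[of "J (J ?g) x"] JJg[of x] M1 by simp
  then have "AE x in mD. Re (\<phi> x) > 0" by (intro AE_mD_I) auto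
  with \<phi>H2 show ?thesis by blast
qed

text \<open>Centring at 1/2 keeps the argument of the cosine strictly below \<omega> in absolute
  value on the open interval. This is why the end point \<omega> = \<pi>/2 is admissible: the zeros
  then lie exactly at 0 and 1.\<close>

lemma positive_solution_constant:
  fixes \<omega> :: real
  assumes q1: "AE x in mD. q x = 1" and \<omega>: "0 < \<omega>" "\<omega> \<le> pi / 2"
  shows "\<exists>\<phi>\<in>H2. (AE x in mD. wderiv2 \<phi> x = - 4 * (of_real \<omega>)\<^sup>2 * (complex_of_real (q x) * \<phi> x))
    \<and> (AE x in mD. Re (\<phi> x) > 0)"
proof -
  define \<phi> where "\<phi> x = complex_of_real (cos (2 * \<omega> * (x - 1/2)))" for x
  define \<phi>' where "\<phi>' x = complex_of_real (- 2 * \<omega> * sin (2 * \<omega> * (x - 1/2)))" for x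
  define g where "g x = complex_of_real (- 4 * \<omega>\<^sup>2 * cos (2 * \<omega> * (x - 1/2)))" for x
  have D1: "(\<phi> has_vector_derivative \<phi>' x) (at x)" for x
    unfolding \<phi>_def[abs_def] \<phi>'_def
    by (intro has_vector_derivative_of_real)
       (auto simp: has_real_derivative_iff_has_vector_derivative[symmetric] intro!: derivative_eq_intros)
  have D2: "(\<phi>' has_vector_derivative g x) (at x)" for x
    unfolding \<phi>'_def[abs_def] g_def
    by (intro has_vector_derivative_of_real)
       (auto simp: has_real_derivative_iff_has_vector_derivative[symmetric] power2_eq_square intro!: derivative_eq_intros)
  have cont: "continuous_on {0..1} \<phi>" "continuous_on {0..1} \<phi>'" "continuous_on {0..1} g"
    unfolding \<phi>_def[abs_def] \<phi>'_def[abs_def] g_def[abs_def] by (intro continuous_intros)+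
  have "\<phi> x = (\<phi> 0) + \<phi>' 0 * of_real x + J (J g) x" if x: "x \<in> {0<..<1}" for x
  proof -
    have "J (J g) x = J (\<lambda>x. \<phi>' x - \<phi>' 0) x"
      by (rule fun_cong[OF J_cong]) (use FTC_J[OF D2 cont(3)] in auto)
    also have "\<dots> = J \<phi>' x - \<phi>' 0 * J (\<lambda>_. 1) x"
      using J_diff[OF FTC_integrable[OF D1 cont(2)], of "\<lambda>_. \<phi>' 0" x] J_cmult[of "\<phi>' 0" "\<lambda>_. 1" x] by simp
    also have "\<dots> = \<phi> x - \<phi> 0 - \<phi>' 0 * of_real x"
      using FTC_J[OF D1 cont(2), of x] J_1[of x] x by simp
    finally show ?thesis by simp
  qed
  then have rep: "AE x in mD. \<phi> x = \<phi> 0 + \<phi>' 0 * of_real x + J (J g) x" by (intro AE_mD_I) auto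
  have meas: "\<phi> \<in> borel_measurable mD" "g \<in> borel_measurable mD"
    unfolding \<phi>_def[abs_def] g_def[abs_def] by measurable
  have "cmod (g x) \<le> 4 * \<omega>\<^sup>2" for x
    by (simp add: g_def norm_mult norm_power mult_left_le)
  then have g: "g \<in> L2" by (intro L2_bounded[OF meas(2)])
  note H2 = H2_I[OF g meas(1) rep]
  have "g x = - 4 * (of_real \<omega>)\<^sup>2 * \<phi> x" for x
    by (simp add: g_def \<phi>_def)
  then have "AE x in mD. wderiv2 \<phi> x = - 4 * (of_real \<omega>)\<^sup>2 * (complex_of_real (q x) * \<phi> x)"
    using H2(2) q1 by (auto elim: eventually_elim2)
  moreover have "AE x in mD. Re (\<phi> x) > 0"
  proof (rule AE_mD_I)
    fix x :: real assume x: "0 < x" "x < 1"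
    have "\<bar>\<omega> * (2 * x - 1)\<bar> = \<omega> * \<bar>2 * x - 1\<bar>" using \<omega> by (simp add: abs_mult)
    also have "\<dots> < \<omega> * 1" using x \<omega> by (intro mult_strict_left_mono) auto
    also have "\<omega> * (2 * x - 1) = 2 * \<omega> * (x - 1/2)" by (simp add: algebra_simps)
    finally have "\<bar>2 * \<omega> * (x - 1/2)\<bar> < pi / 2" using \<omega> by simp
    then have "cos (2 * \<omega> * (x - 1/2)) > 0" by (intro cos_gt_zero_pi) auto
    then show "Re (\<phi> x) > 0" by (simp add: \<phi>_def)
  qed
  ultimately show ?thesis using H2(1) by blast
qed

theorem lemma2p8:
  fixes q :: "real \<Rightarrow> real"
  assumes "q \<in> Linfty"
  shows
    "(\<exists>\<delta>::real. \<delta> > 0 \<and>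
        (\<forall>\<chi>1\<in>Linfty. \<forall>\<chi>2\<in>Linfty. (AE x in mD. \<chi>2 x > 0) \<longrightarrow>
          (\<forall>\<omega>::real. 0 < \<omega> \<and> \<omega> \<le> \<delta> \<longrightarrow>
            (\<forall>u\<in>X_space. \<not> X_eq u X_zero \<and> (AE x in mD. fst u x \<in> \<real>) \<longrightarrow>
              \<not> X_eq (T q \<chi>1 \<chi>2 (complex_of_real \<omega>) u) X_zero))))
     \<and> ((AE x in mD. q x = 1) \<longrightarrow>
        (\<forall>\<chi>1\<in>Linfty. \<forall>\<chi>2\<in>Linfty. (AE x in mD. \<chi>2 x > 0) \<longrightarrow>
          (\<forall>\<omega>::real. 0 < \<omega> \<and> \<omega> \<le> pi / 2 \<longrightarrow>
            (\<forall>u\<in>X_space. \<not> X_eq u X_zero \<and> (AE x in mD. fst u x \<in> \<real>) \<longrightarrow>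
              \<not> X_eq (T q \<chi>1 \<chi>2 (complex_of_real \<omega>) u) X_zero))))"
proof (intro conjI impI)
  obtain Q where Q: "AE x in mD. \<bar>q x\<bar> \<le> Q" using assms by (auto simp: Linfty_def)
  \<comment> \<open>Solves 16 \<delta>^2 (|Q| + 1) = 1; the added 1 covers \<open>Q = 0\<close>.
    Only a bound for \<open>q\<close> enters, so \<delta> is fixed before \<chi>1 and
    \<chi>2.\<close>
  define \<delta> where "\<delta> = 1 / sqrt (16 * (\<bar>Q\<bar> + 1))"
  have \<delta>: "\<delta> > 0" by (simp add: \<delta>_def)
  have small: "16 * \<omega>\<^sup>2 * Q \<le> 1" if "0 < \<omega>" "\<omega> \<le> \<delta>" for \<omega>
  proof -
    have "16 * \<omega>\<^sup>2 * Q \<le> 16 * \<omega>\<^sup>2 * (\<bar>Q\<bar> + 1)" by (intro mult_left_mono) auto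
    also have "\<dots> \<le> 16 * \<delta>\<^sup>2 * (\<bar>Q\<bar> + 1)"
      using that by (intro mult_right_mono mult_left_mono power_mono) auto
    also have "\<dots> = 1" by (simp add: \<delta>_def power_divide)
    finally show ?thesis .
  qed
  show "\<exists>\<delta>::real. \<delta> > 0 \<and>
        (\<forall>\<chi>1\<in>Linfty. \<forall>\<chi>2\<in>Linfty. (AE x in mD. \<chi>2 x > 0) \<longrightarrow>
          (\<forall>\<omega>::real. 0 < \<omega> \<and> \<omega> \<le> \<delta> \<longrightarrow>
            (\<forall>u\<in>X_space. \<not> X_eq u X_zero \<and> (AE x in mD. fst u x \<in> \<real>) \<longrightarrow>
              \<not> X_eq (T q \<chi>1 \<chi>2 (complex_of_real \<omega>) u) X_zero)))"
    using positive_solution_small_frequency[OF assms Q small] T_injective_at_zero[OF assms] \<delta>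
    by (intro exI[of _ \<delta>]) blast
next
  assume "AE x in mD. q x = 1"
  from positive_solution_constant[OF this] T_injective_at_zero[OF assms]
  show "\<forall>\<chi>1\<in>Linfty. \<forall>\<chi>2\<in>Linfty. (AE x in mD. \<chi>2 x > 0) \<longrightarrow>
          (\<forall>\<omega>::real. 0 < \<omega> \<and> \<omega> \<le> pi / 2 \<longrightarrow>
            (\<forall>u\<in>X_space. \<not> X_eq u X_zero \<and> (AE x in mD. fst u x \<in> \<real>) \<longrightarrow>
              \<not> X_eq (T q \<chi>1 \<chi>2 (complex_of_real \<omega>) u) X_zero))"
    by blast
qed

end
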